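(* Let $\mathfrak n=\mathfrak n_{-2}\oplus\mathfrak n_{-1}$ be a real $M$-type algebra with $\dim_{\mathbb R}\mathfrak n_{-2}\geq 3$ which satisfies the following condition (C): there exist three linearly independent vectors $z_1,z_2,z_3\in\mathfrak n_{-2}$ such that the maps $J_{z_1},J_{z_2},J_{z_3}$ are non-degenerate and $J_{z_i}J_{z_j}=\sigma_{ij}J_{z_j}J_{z_i}$ for all $i,j\in\{1,2,3\}$, where $\sigma_{ij}\in\{-1,1\}$ and $\sigma_{12}\sigma_{13}\sigma_{23}=-1$. Then $\mathfrak n$ is rigid.
   Context: A graded 2-step nilpotent Lie algebra $\mathfrak n=\mathfrak n_{-2}\oplus\mathfrak n_{-1}$ has $[\mathfrak n_{-1},\mathfrak n_{-1}]=\mathfrak n_{-2}$ and $\mathfrak n_{-2}$ central; it is assumed fundamental, i.e. the center of $\mathfrak n$ is exactly $\mathfrak n_{-2}$ (no nonzero element of $\mathfrak n_{-1}$ is central). An $M$-type algebra is such an $\mathfrak n$ together with a non-degenerate symmetric bilinear form $\langle\cdot,\cdot\rangle$ on $\mathfrak n$ whose restriction to $\mathfrak n_{-2}$ is non-degenerate and for which $\mathfrak n_{-2}\perp\mathfrak n_{-1}$. The $J$-map $J\colon\mathfrak n_{-2}\to\operatorname{End}(\mathfrak n_{-1})$ is defined by $\langle J_zx,y\rangle=\langle z,[x,y]\rangle$ for all $x,y\in\mathfrak n_{-1}$, $z\in\mathfrak n_{-2}$. The Tanaka prolongation of $\mathfrak n$ is the maximal graded Lie algebra $\hat{\mathfrak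 n}=\bigoplus_{i\ge -2}\hat{\mathfrak n}_i$ with $\hat{\mathfrak n}_{-2}\oplus\hat{\mathfrak n}_{-1}=\mathfrak n$ (as graded Lie algebras) such that for $k\ge0$ any $X\in\hat{\mathfrak n}_k$ with $[X,\mathfrak n_{-1}]=0$ is zero. $\mathfrak n$ is rigid (of finite type) if $\hat{\mathfrak n}$ is finite dimensional, and of infinite type otherwise. *)

theory Defs
  imports "HOL-Analysis.Analysis"
begin

text \<open>A graded 2-step nilpotent real Lie algebra n = n_{-2} (+) n_{-1} is modelled by
  finite-dimensional real spaces 'z (= n_{-2}) and 'v (= n_{-1}) and the bracket
  B : n_{-1} x n_{-1} -> n_{-2}; n_{-2} is central, so this determines the whole bracket.
  Elements of n are pairs (z, v) :: 'z \<times> 'v.\<close>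

definition graded_2step :: "('v::real_vector \<Rightarrow> 'v \<Rightarrow> 'z::real_vector) \<Rightarrow> bool" where
  "graded_2step B \<longleftrightarrow> bilinear B \<and> (\<forall>x y. B x y = - B y x)
      \<and> span (range (\<lambda>(x,y). B x y)) = UNIV"

definition fundamental :: "('v::real_vector \<Rightarrow> 'v \<Rightarrow> 'z::real_vector) \<Rightarrow> bool" where
  "fundamental B \<longleftrightarrow> (\<forall>x. (\<forall>y. B x y = 0) \<longrightarrow> x = 0)"

definition M_type :: "('v::real_vector \<Rightarrow> 'v \<Rightarrow> 'z::real_vector)
     \<Rightarrow> ('z \<times> 'v \<Rightarrow> 'z \<times> 'v \<Rightarrow> real) \<Rightarrow> bool" where
  "M_type B q \<longleftrightarrow> graded_2step B \<and> fundamental B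
     \<and> bilinear q \<and> (\<forall>a b. q a b = q b a)
     \<and> (\<forall>a. (\<forall>b. q a b = 0) \<longrightarrow> a = 0)
     \<and> (\<forall>z. (\<forall>z'. q (z,0) (z',0) = 0) \<longrightarrow> z = 0)
     \<and> (\<forall>z v. q (z,0) (0,v) = 0)"

definition Jmap :: "('v::real_vector \<Rightarrow> 'v \<Rightarrow> 'z::real_vector)
     \<Rightarrow> ('z \<times> 'v \<Rightarrow> 'z \<times> 'v \<Rightarrow> real) \<Rightarrow> 'z \<Rightarrow> 'v \<Rightarrow> 'v" where
  "Jmap B q z = (THE f. \<forall>x y. q (0, f x) (0, y) = q (z, 0) (B x y, 0))"

text \<open>Elements of the graded pieces of the prolongation. TZ z : degree -2, TV v : degree -1,
  TP f g : degree k >= 0, where f : n_{-1} -> g_{k-1} and g : n_{-2} -> g_{k-2}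
  (an element of g_k is a degree-k map on n with values in the lower pieces, as in Tanaka).\<close>
datatype ('v, 'z) tel = TZ 'z | TV 'v | TP "'v \<Rightarrow> ('v, 'z) tel" "'z \<Rightarrow> ('v, 'z) tel"

primrec tadd :: "('v::real_vector, 'z::real_vector) tel \<Rightarrow> ('v, 'z) tel \<Rightarrow> ('v, 'z) tel" where
  "tadd (TZ a) t = (case t of TZ b \<Rightarrow> TZ (a + b) | _ \<Rightarrow> TZ a)"
| "tadd (TV a) t = (case t of TV b \<Rightarrow> TV (a + b) | _ \<Rightarrow> TV a)"
| "tadd (TP f g) t = (case t of TP f' g' \<Rightarrow> TP (\<lambda>v. tadd (f v) (f' v)) (\<lambda>z. tadd (g z) (g' z))
                        | _ \<Rightarrow> TP f g)"

primrec tscale :: "real \<Rightarrow> ('v::real_vector, 'z::real_vector) tel \<Rightarrow> ('v, 'z) tel" where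
  "tscale c (TZ a) = TZ (c *\<^sub>R a)"
| "tscale c (TV a) = TV (c *\<^sub>R a)"
| "tscale c (TP f g) = TP (\<lambda>v. tscale c (f v)) (\<lambda>z. tscale c (g z))"

text \<open>Zero of degree d - 2.\<close>
fun tzero :: "nat \<Rightarrow> ('v::real_vector, 'z::real_vector) tel" where
  "tzero 0 = TZ 0"
| "tzero (Suc 0) = TV 0"
| "tzero (Suc (Suc n)) = TP (\<lambda>_. tzero (Suc n)) (\<lambda>_. tzero n)"

text \<open>Bracket [X, y] of a prolongation element with y in n_{-1} resp. n_{-2}.
  For X in g_{-1} this is the bracket of n; n_{-2} is central; for X of degree >= 0 it is
  evaluation.  Brackets landing in degree < -2 are represented by TZ 0.\<close>
fun brV :: "('v::real_vector \<Rightarrow> 'v \<Rightarrow> 'z::real_vector) \<Rightarrow> ('v, 'z) tel \<Rightarrow> 'v \<Rightarrow> ('v, 'z) tel" where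
  "brV B (TZ a) y = TZ 0"
| "brV B (TV a) y = TZ (B a y)"
| "brV B (TP f g) y = f y"

fun brZ :: "('v, 'z::real_vector) tel \<Rightarrow> 'z \<Rightarrow> ('v, 'z) tel" where
  "brZ (TZ a) z = TZ 0"
| "brZ (TV a) z = TZ 0"
| "brZ (TP f g) z = g z"

text \<open>tanaka B d is the piece of degree d - 2 of the Tanaka prolongation:
  g_{-2} = n_{-2}, g_{-1} = n_{-1}, and for k >= 0, g_k is the space of pairs of linear maps
  f : n_{-1} -> g_{k-1}, g : n_{-2} -> g_{k-2} such that the induced degree-k map phi on n
  satisfies phi[a,b] = [phi a, b] + [a, phi b] for all homogeneous a, b in n.\<close>
fun tanaka :: "('v::real_vector \<Rightarrow> 'v \<Rightarrow> 'z::real_vector) \<Rightarrow> nat \<Rightarrow> ('v, 'z) tel set" where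
  "tanaka B 0 = range TZ"
| "tanaka B (Suc 0) = range TV"
| "tanaka B (Suc (Suc n)) = {TP f g | f g.
      (\<forall>x. f x \<in> tanaka B (Suc n)) \<and> (\<forall>z. g z \<in> tanaka B n)
    \<and> (\<forall>x y. f (x + y) = tadd (f x) (f y)) \<and> (\<forall>c x. f (c *\<^sub>R x) = tscale c (f x))
    \<and> (\<forall>z w. g (z + w) = tadd (g z) (g w)) \<and> (\<forall>c z. g (c *\<^sub>R z) = tscale c (g z))
    \<and> (\<forall>x y. g (B x y) = tadd (brV B (f x) y) (tscale (-1) (brV B (f y) x)))
    \<and> (\<forall>x z. brZ (f x) z = brV B (g z) x)
    \<and> (\<forall>z w. brZ (g z) w = brZ (g w) z)}"

text \<open>Rigid (finite type): the prolongation is finite-dimensional.  Each graded piece is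
  finite-dimensional, so this means that all but finitely many pieces are zero.\<close>
definition rigid :: "('v::real_vector \<Rightarrow> 'v \<Rightarrow> 'z::real_vector) \<Rightarrow> bool" where
  "rigid B \<longleftrightarrow> finite {d. tanaka B d \<noteq> {tzero d}}"

end

theory Submission
  imports Defs "HOL-Library.Function_Algebras"
begin

text \<open>
  An element \<open>u\<close> of the prolongation is encoded by its iterated brackets with words in \<open>\<nn>\<^sub>-\<^sub>1\<close> and
  \<open>\<nn>\<^sub>-\<^sub>2\<close>. If \<open>u\<close> has degree 1 and \<open>[u, \<nn>\<^sub>-\<^sub>2] = 0\<close>, then \<open>A x y = [[u, x], y]\<close> is symmetric and every \<open>A x\<close>
  commutes with \<open>K = J\<^sub>1\<inverse>J\<^sub>2\<close> and \<open>L = J\<^sub>1\<inverse>J\<^sub>3\<close>. By condition (C) these anticommute, whence \<open>u = 0\<close>.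
  Therefore the dual of the prolongation is a finitely generated module over the symmetric algebra
  of \<open>\<nn>\<^sub>-\<^sub>2\<close>, and \<open>ad y\<close> with \<open>y \<in> \<nn>\<^sub>-\<^sub>1\<close> satisfies a monic equation of some degree \<open>r\<close> over that algebra.
  Taking \<open>r\<close> commutators of the equation with \<open>ad x\<close> gives \<open>r! (ad [x, y])^r = 0\<close>. As the brackets span \<open>\<nn>\<^sub>-\<^sub>2\<close>,
  all sufficiently long products of elements of \<open>ad \<nn>\<^sub>-\<^sub>2\<close> vanish, which bounds the degree.
\<close>

section \<open>Operators in a Heisenberg relation\<close>

instantiation "fun" :: (type, real_vector) real_vector
begin

definition scaleR_fun :: "real \<Rightarrow> ('a \<Rightarrow> 'b) \<Rightarrow> 'a \<Rightarrow> 'b" where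
  "scaleR_fun c f = (\<lambda>x. c *\<^sub>R f x)"

instance
  by standard (auto simp: scaleR_fun_def fun_eq_iff scaleR_add_right scaleR_add_left)

end

lemma scaleR_fun_apply [simp]: "(c *\<^sub>R f) x = c *\<^sub>R f x"
  by (simp add: scaleR_fun_def)

text \<open>Since \<open>Q\<close> may be infinite-dimensional, the induction runs over the
  functionals: restricting \<open>Q\<close> to the kernel of one of them removes it, and its
  coefficient is recovered at a vector \<open>b\<close> where it takes the value 1.\<close>

lemma functional_combination:
  fixes Q :: "'e::real_vector set" and \<mu> :: "'i \<Rightarrow> 'e \<Rightarrow> real"
  assumes "finite I" "subspace Q" "\<And>i. i \<in> I \<Longrightarrow> linear (\<mu> i)" "linear f"
    and "\<And>e. e \<in> Q \<Longrightarrow> (\<forall>i\<in>I. \<mu> i e = 0) \<Longrightarrow> f e = 0"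
  shows "\<exists>c. \<forall>e\<in>Q. f e = (\<Sum>i\<in>I. c i * \<mu> i e)"
  using assms
proof (induction I arbitrary: Q rule: finite_induct)
  case empty
  then show ?case by auto
next
  case (insert i I)
  have lin: "linear (\<mu> i)" "\<And>j. j \<in> I \<Longrightarrow> linear (\<mu> j)" using insert.prems by auto
  define Q' where "Q' = {e\<in>Q. \<mu> i e = 0}"
  have "subspace Q'"
    using \<open>subspace Q\<close> lin(1) unfolding Q'_def subspace_def
    by (auto simp: linear_0 linear_add linear_scale)
  moreover have "f e = 0" if "e \<in> Q'" "\<forall>j\<in>I. \<mu> j e = 0" for e
    using that insert.prems(4)[of e] by (auto simp: Q'_def)
  ultimately obtain c where c: "\<And>e. e \<in> Q' \<Longrightarrow> f e = (\<Sum>j\<in>I. c j * \<mu> j e)"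
    using insert.IH[of Q'] lin(2) \<open>linear f\<close> by blast
  show ?case
  proof (cases "\<forall>e\<in>Q. \<mu> i e = 0")
    case True
    then have "f e = (\<Sum>j\<in>insert i I. c j * \<mu> j e)" if "e \<in> Q" for e
      using that c[of e] insert.hyps by (simp add: Q'_def)
    then show ?thesis by blast
  next
    case False
    then obtain a where a: "a \<in> Q" "\<mu> i a \<noteq> 0" by blast
    define b where "b = (1 / \<mu> i a) *\<^sub>R a"
    have b: "b \<in> Q" "\<mu> i b = 1"
      using a \<open>subspace Q\<close> lin(1) by (auto simp: b_def subspace_scale linear_scale)
    define c' where "c' = c(i := f b - (\<Sum>j\<in>I. c j * \<mu> j b))"
    have "f e = (\<Sum>j\<in>insert i I. c' j * \<mu> j e)" if e: "e \<in> Q" for e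
    proof -
      let ?d = "e - \<mu> i e *\<^sub>R b"
      have "?d \<in> Q'"
        using e b \<open>subspace Q\<close> lin(1)
        by (simp add: Q'_def subspace_diff subspace_scale linear_diff linear_scale)
      then have "f ?d = (\<Sum>j\<in>I. c j * \<mu> j ?d)" by (rule c)
      also have "\<dots> = (\<Sum>j\<in>I. c j * \<mu> j e - \<mu> i e * (c j * \<mu> j b))"
        by (rule sum.cong) (simp_all add: linear_diff[OF lin(2)] linear_scale[OF lin(2)] algebra_simps)
      also have "\<dots> = (\<Sum>j\<in>I. c j * \<mu> j e) - \<mu> i e * (\<Sum>j\<in>I. c j * \<mu> j b)"
        by (simp add: sum_subtractf sum_distrib_left)
      finally have "f e = \<mu> i e * f b + (\<Sum>j\<in>I. c j * \<mu> j e) - \<mu> i e * (\<Sum>j\<in>I. c j * \<mu> j b)"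
        using \<open>linear f\<close> by (simp add: linear_diff linear_scale)
      moreover have "(\<Sum>j\<in>I. c' j * \<mu> j e) = (\<Sum>j\<in>I. c j * \<mu> j e)"
        using insert.hyps by (intro sum.cong) (auto simp: c'_def)
      ultimately show ?thesis
        using insert.hyps by (simp add: c'_def algebra_simps)
    qed
    then show ?thesis by blast
  qed
qed

section \<open>Polynomials in one operator over a commuting family of coefficients\<close>

inductive deg_le :: "('e::real_vector \<Rightarrow> 'e) set \<Rightarrow> ('e \<Rightarrow> 'e) \<Rightarrow> nat \<Rightarrow> ('e \<Rightarrow> 'e) \<Rightarrow> bool"
  for S Y where
  zero: "deg_le S Y d (\<lambda>e. 0)"
| ident: "deg_le S Y d (\<lambda>e. e)"
| add: "deg_le S Y d T \<Longrightarrow> deg_le S Y d T' \<Longrightarrow> deg_le S Y d (\<lambda>e. T e + T' e)"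
| scale: "deg_le S Y d T \<Longrightarrow> deg_le S Y d (\<lambda>e. c *\<^sub>R T e)"
| coeff: "deg_le S Y d T \<Longrightarrow> s \<in> S \<Longrightarrow> deg_le S Y d (\<lambda>e. T (s e))"
| var: "deg_le S Y d T \<Longrightarrow> deg_le S Y (Suc d) (\<lambda>e. T (Y e))"

lemma deg_le_mono: "deg_le S Y d T \<Longrightarrow> d \<le> d' \<Longrightarrow> deg_le S Y d' T"
proof (induction arbitrary: d' rule: deg_le.induct)
  case (var d T)
  then obtain m where "d' = Suc m" "d \<le> m" by (cases d') auto
  then show ?case using var by (auto intro: deg_le.var)
qed (auto intro: deg_le.intros)

text \<open>The rule \<open>var\<close> never yields degree 0, so degree 0 means built from
  \<open>S\<close> alone. This permits a change of \<open>Y\<close> when only coefficients are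
  involved.\<close>

lemma deg_le_0_indep: "deg_le S Y d T \<Longrightarrow> d = 0 \<Longrightarrow> deg_le S Y' 0 T"
  by (induction rule: deg_le.induct) (auto intro: deg_le.intros)

lemma deg_le_diff:
  "deg_le S Y d T \<Longrightarrow> deg_le S Y d T' \<Longrightarrow> deg_le S Y d (\<lambda>e. T e - T' e)"
  using deg_le.add[OF _ deg_le.scale[of S Y d T' "-1"]] by (simp add: fun_eq_iff)

text \<open>The leading exponent is one more than the index, so the index itself bounds the degree
  of the lower terms.\<close>

definition monic :: "('e::real_vector \<Rightarrow> 'e) set \<Rightarrow> ('e \<Rightarrow> 'e) \<Rightarrow> nat \<Rightarrow> ('e \<Rightarrow> 'e) \<Rightarrow> bool" where
  "monic S Y d T \<longleftrightarrow> (\<exists>R. deg_le S Y d R \<and> T = (\<lambda>e. (Y ^^ Suc d) e + R e))"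

text \<open>Commutation is demanded only on the invariant subspace \<open>Q\<close>: shifts of
  arbitrary functions on words do not commute, whereas on word functions the central shifts commute
  with all others.\<close>

locale commuting_operators =
  fixes Q :: "'e::real_vector set" and S :: "('e \<Rightarrow> 'e) set" and Y :: "'e \<Rightarrow> 'e"
  assumes subspace_Q: "subspace Q"
    and linear_Y: "linear Y" and Y_closed: "e \<in> Q \<Longrightarrow> Y e \<in> Q"
    and linear_S: "s \<in> S \<Longrightarrow> linear s" and S_closed: "s \<in> S \<Longrightarrow> e \<in> Q \<Longrightarrow> s e \<in> Q"
    and S_comm: "s \<in> S \<Longrightarrow> t \<in> S \<Longrightarrow> e \<in> Q \<Longrightarrow> s (t e) = t (s e)"
    and S_Y: "s \<in> S \<Longrightarrow> e \<in> Q \<Longrightarrow> s (Y e) = Y (s e)"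
begin

lemma deg_le_linear: "deg_le S Y d T \<Longrightarrow> linear T"
proof (induction rule: deg_le.induct)
  case (coeff d T s)
  then show ?case using linear_compose[OF linear_S[of s] coeff.IH] by (simp add: o_def)
next
  case (var d T)
  then show ?case using linear_compose[OF linear_Y var.IH] by (simp add: o_def)
qed (auto intro: linear_compose_add linear_compose_scale_right linear_ident linear_zero)

lemma deg_le_closed: "deg_le S Y d T \<Longrightarrow> e \<in> Q \<Longrightarrow> T e \<in> Q"
  by (induction arbitrary: e rule: deg_le.induct)
    (auto simp: subspace_0 subspace_add subspace_scale subspace_Q Y_closed S_closed)

lemma deg_le_S: "deg_le S Y d T \<Longrightarrow> s \<in> S \<Longrightarrow> e \<in> Q \<Longrightarrow> T (s e) = s (T e)"
proof (induction arbitrary: e rule: deg_le.induct)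
  case (coeff d T t)
  then show ?case using S_comm[of t s e] S_closed by simp
qed (auto simp: linear_0 linear_add linear_scale linear_S Y_closed S_Y[symmetric])

lemma deg_le_Y: "deg_le S Y d T \<Longrightarrow> e \<in> Q \<Longrightarrow> T (Y e) = Y (T e)"
  by (induction arbitrary: e rule: deg_le.induct)
    (auto simp: linear_0 linear_add linear_scale linear_Y S_closed Y_closed S_Y)

lemma deg_le_comm:
  "deg_le S Y d T \<Longrightarrow> deg_le S Y d' T' \<Longrightarrow> e \<in> Q \<Longrightarrow> T (T' e) = T' (T e)"
proof (induction arbitrary: e rule: deg_le.induct)
  case (coeff d T s)
  then show ?case using deg_le_S[of d' T' s e] coeff.IH[of "s e"] S_closed by simp
next
  case (var d T)
  then show ?case using deg_le_Y[of d' T' e] var.IH[of "Y e"] Y_closed by simp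
qed (auto simp: linear_0 linear_add linear_scale dest: deg_le_linear)

lemma deg_le_compose:
  assumes "deg_le S Y a T"
  shows "deg_le S Y b T' \<Longrightarrow> deg_le S Y (a + b) (\<lambda>e. T (T' e))"
proof (induction rule: deg_le.induct)
  case (zero d)
  then show ?case using assms deg_le_linear[OF assms] by (simp add: linear_0 deg_le.zero)
next
  case (ident d)
  then show ?case using assms deg_le_mono[of S Y a T "a + d"] by simp
next
  case (add d T1 T2)
  then show ?case using deg_le_linear[OF assms] by (simp add: linear_add deg_le.add)
next
  case (scale d T1 c)
  then show ?case using deg_le_linear[OF assms] by (simp add: linear_scale deg_le.scale)
next
  case (coeff d T1 s)
  then show ?case using deg_le.coeff[of S Y "a + d" "\<lambda>e. T (T1 e)" s] by simp
next
  case (var d T1)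
  then show ?case using deg_le.var[of S Y "a + d" "\<lambda>e. T (T1 e)"] by simp
qed

lemma deg_le_power: "deg_le S Y d (Y ^^ d)"
proof (induction d)
  case 0
  then show ?case using deg_le.ident[of S Y 0] by (simp add: id_def)
next
  case (Suc d)
  then show ?case using deg_le.var[OF Suc] by (simp add: o_def del: funpow.simps add: funpow_Suc_right)
qed

lemma monic_deg_le:
  assumes "monic S Y d T"
  shows "deg_le S Y (Suc d) T"
proof -
  obtain R where "deg_le S Y d R" "T = (\<lambda>e. (Y ^^ Suc d) e + R e)"
    using assms unfolding monic_def by blast
  then show ?thesis
    using deg_le.add[OF deg_le_power[of "Suc d"] deg_le_mono[of S Y d R "Suc d"]] by simp
qed

lemma monic_minus:
  assumes "monic S Y d T" "deg_le S Y d T'"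
  shows "monic S Y d (\<lambda>e. T e - T' e)"
proof -
  obtain R where "deg_le S Y d R" "T = (\<lambda>e. (Y ^^ Suc d) e + R e)"
    using assms(1) unfolding monic_def by blast
  then show ?thesis
    unfolding monic_def using assms(2)
    by (intro exI[of _ "\<lambda>e. R e - T' e"]) (auto intro: deg_le_diff simp del: funpow.simps)
qed

lemma monic_compose:
  assumes "monic S Y a T" "monic S Y b T'"
  shows "monic S Y (Suc (a + b)) (\<lambda>e. T (T' e))"
proof -
  obtain R where R: "deg_le S Y a R" "T = (\<lambda>e. (Y ^^ Suc a) e + R e)"
    using assms(1) unfolding monic_def by blast
  obtain R' where R': "deg_le S Y b R'" "T' = (\<lambda>e. (Y ^^ Suc b) e + R' e)"
    using assms(2) unfolding monic_def by blast
  have "(Y ^^ Suc a) ((Y ^^ Suc b) e) = (Y ^^ Suc (Suc (a + b))) e" for e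
    using funpow_add[of "Suc a" "Suc b" Y] by (simp del: funpow.simps)
  then have "T (T' e) = (Y ^^ Suc (Suc (a + b))) e + ((Y ^^ Suc a) (R' e) + R (T' e))" for e
    using deg_le_linear[OF deg_le_power[of "Suc a"]]
    by (simp add: R(2) R'(2) linear_add add.assoc del: funpow.simps)
  moreover have "deg_le S Y (Suc (a + b)) (\<lambda>e. (Y ^^ Suc a) (R' e) + R (T' e))"
    using deg_le_compose[OF deg_le_power[of "Suc a"] R'(1)]
      deg_le_compose[OF R(1) monic_deg_le[OF assms(2)]]
    by (intro deg_le.add) (simp_all del: funpow.simps)
  ultimately show ?thesis unfolding monic_def by blast
qed

text \<open>This plays the role of the Cayley--Hamilton theorem for the action of \<open>Y\<close> on the
  module generated by the \<open>\<mu> i\<close>. The functional \<open>\<mu> k\<close> is eliminated by multiplying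
  all relations with \<open>p - q k k\<close>, which keeps the left-hand side monic.\<close>

lemma monic_annihilator:
  assumes "finite I" "\<And>i. i \<in> I \<Longrightarrow> linear (\<mu> i :: 'e \<Rightarrow> real)" "monic S Y d p"
    and "\<And>i j. i \<in> I \<Longrightarrow> j \<in> I \<Longrightarrow> deg_le S Y d (q i j)"
    and "\<And>i e. i \<in> I \<Longrightarrow> e \<in> Q \<Longrightarrow> \<mu> i (p e) = (\<Sum>j\<in>I. \<mu> j (q i j e))"
  shows "\<exists>d P. monic S Y d P \<and> (\<forall>i\<in>I. \<forall>e\<in>Q. \<mu> i (P e) = 0)"
  using assms
proof (induction I arbitrary: d p q rule: finite_induct)
  case empty
  then show ?case by blast
next
  case (insert k I)
  note mon_p = insert.prems(2) and deg_q = insert.prems(3) and rel = insert.prems(4)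
  have lin: "linear (\<mu> k)" "\<And>j. j \<in> I \<Longrightarrow> linear (\<mu> j)" using insert.prems by auto
  define s where "s = (\<lambda>e. p e - q k k e)"
  have mon_s: "monic S Y d s" unfolding s_def by (rule monic_minus) (use insert.prems in auto)
  note deg_s = monic_deg_le[OF mon_s] and deg_p = monic_deg_le[OF mon_p]
  have k_rel: "\<mu> k (s e) = (\<Sum>j\<in>I. \<mu> j (q k j e))" if "e \<in> Q" for e
    using rel[of k e] that insert.hyps lin(1) by (simp add: s_def linear_diff)
  \<comment> \<open>In the relation for \<open>i\<close> at \<open>s e\<close>, the term
    \<open>\<mu> k (q i k (s e))\<close> equals \<open>\<mu> k (s (q i k e))\<close>, which
    \<open>k_rel\<close> rewrites through the other functionals. Both summands have degree at most
    \<open>d + Suc d\<close>, one less than the degree of \<open>p\<close> composed with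
    \<open>s\<close>.\<close>
  define q' where "q' = (\<lambda>i j e. q i j (s e) + q k j (q i k e))"
  have "monic S Y (Suc (d + d)) (\<lambda>e. p (s e))" by (rule monic_compose[OF mon_p mon_s])
  moreover have "deg_le S Y (Suc (d + d)) (q' i j)" if "i \<in> I" "j \<in> I" for i j
    unfolding q'_def
    using that deg_le_compose[OF deg_q[of i j] deg_s] deg_le_compose[OF deg_q[of k j] deg_q[of i k]]
    by (intro deg_le.add) (auto intro: deg_le_mono)
  moreover have "\<mu> i (p (s e)) = (\<Sum>j\<in>I. \<mu> j (q' i j e))" if "i \<in> I" "e \<in> Q" for i e
  proof -
    have "q i k (s e) = s (q i k e)" using deg_le_comm[OF deg_q[of i k] deg_s] that by auto
    moreover have "q i k e \<in> Q" using deg_le_closed[OF deg_q[of i k]] that by auto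
    ultimately have "\<mu> k (q i k (s e)) = (\<Sum>j\<in>I. \<mu> j (q k j (q i k e)))"
      using k_rel by simp
    moreover have "\<mu> i (p (s e)) = \<mu> k (q i k (s e)) + (\<Sum>j\<in>I. \<mu> j (q i j (s e)))"
      using rel[of i "s e"] that insert.hyps deg_le_closed[OF deg_s] by simp
    ultimately show ?thesis
      by (simp add: q'_def linear_add[OF lin(2)] sum.distrib)
  qed
  ultimately obtain d' P where P: "monic S Y d' P" "\<forall>i\<in>I. \<forall>e\<in>Q. \<mu> i (P e) = 0"
    using insert.IH[of "Suc (d + d)" "\<lambda>e. p (s e)" q'] lin(2) by blast
  note deg_P = monic_deg_le[OF P(1)]
  \<comment> \<open>\<open>P\<close> takes care of the functionals in \<open>I\<close>. The extra
    factor \<open>s\<close> also kills \<open>\<mu> k\<close>, because \<open>k_rel\<close> turns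
    \<open>\<mu> k (s (P e))\<close> into a sum of terms \<open>\<mu> j (P (q k j e))\<close> with
    \<open>j \<in> I\<close>.\<close>
  have "\<mu> i (s (P e)) = 0" if i: "i \<in> insert k I" and e: "e \<in> Q" for i e
  proof (cases "i = k")
    case True
    have "q k j (P e) = P (q k j e)" if "j \<in> I" for j
      using deg_le_comm[OF deg_q[of k j] deg_P] that e by auto
    then have "\<mu> k (s (P e)) = (\<Sum>j\<in>I. \<mu> j (P (q k j e)))"
      using k_rel[of "P e"] deg_le_closed[OF deg_P e] by simp
    also have "\<dots> = 0"
      using P(2) deg_le_closed[OF deg_q e] by (intro sum.neutral) auto
    finally show ?thesis using True by simp
  next
    case False
    then show ?thesis
      using P(2) i e deg_le_comm[OF deg_s deg_P e] deg_le_closed[OF deg_s e] by auto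
  qed
  then show ?case using monic_compose[OF mon_s P(1)] by blast
qed

end

section \<open>Commutators with a Heisenberg partner and nilpotency of the central operator\<close>

locale heisenberg_operators = commuting_operators Q S Y
  for Q :: "'e::real_vector set" and S Y +
  fixes X Z :: "'e \<Rightarrow> 'e"
  assumes linear_X: "linear X" and X_closed: "e \<in> Q \<Longrightarrow> X e \<in> Q"
    and S_X: "s \<in> S \<Longrightarrow> e \<in> Q \<Longrightarrow> s (X e) = X (s e)"
    and Z_S: "Z \<in> S" and commutator: "e \<in> Q \<Longrightarrow> X (Y e) - Y (X e) = Z e"
begin

text \<open>The commutator with \<open>X\<close> acts on polynomials in \<open>Y\<close> as formal
  differentiation followed by a factor \<open>Z\<close>, and \<open>T'\<close> is the derivative of
  \<open>T\<close>. For \<open>d = 0\<close> it has to be literally zero, as \<open>d - 1\<close> is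
  truncated.\<close>

lemma deg_le_commutator:
  assumes "deg_le S Y d T"
  shows "\<exists>T'. (if d = 0 then T' = (\<lambda>e. 0) else deg_le S Y (d - 1) T')
    \<and> (\<forall>e\<in>Q. X (T e) - T (X e) = T' (Z e))"
  using assms
proof (induction rule: deg_le.induct)
  case (zero d)
  then show ?case
    using linear_X by (intro exI[of _ "\<lambda>e. 0"]) (auto simp: linear_0 intro: deg_le.zero)
next
  case (ident d)
  then show ?case by (intro exI[of _ "\<lambda>e. 0"]) (auto intro: deg_le.zero)
next
  case (add d T1 T2)
  then obtain T1' T2' where
    "if d = 0 then T1' = (\<lambda>e. 0) else deg_le S Y (d - 1) T1'" "\<forall>e\<in>Q. X (T1 e) - T1 (X e) = T1' (Z e)"
    "if d = 0 then T2' = (\<lambda>e. 0) else deg_le S Y (d - 1) T2'" "\<forall>e\<in>Q. X (T2 e) - T2 (X e) = T2' (Z e)"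
    by blast
  then show ?case
    using linear_X
    by (intro exI[of _ "\<lambda>e. T1' e + T2' e"])
      (auto simp: linear_add algebra_simps split: if_splits intro: deg_le.add)
next
  case (scale d T1 c)
  then obtain T1' where
    "if d = 0 then T1' = (\<lambda>e. 0) else deg_le S Y (d - 1) T1'" "\<forall>e\<in>Q. X (T1 e) - T1 (X e) = T1' (Z e)"
    by blast
  then show ?case
    using linear_X
    by (intro exI[of _ "\<lambda>e. c *\<^sub>R T1' e"])
      (auto simp: linear_scale scaleR_diff_right[symmetric] split: if_splits intro: deg_le.scale)
next
  case (coeff d T1 s)
  then obtain T1' where
    "if d = 0 then T1' = (\<lambda>e. 0) else deg_le S Y (d - 1) T1'" "\<forall>e\<in>Q. X (T1 e) - T1 (X e) = T1' (Z e)"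
    by blast
  moreover have "s (Z e) = Z (s e) \<and> s (X e) = X (s e) \<and> s e \<in> Q" if "e \<in> Q" for e
    using S_comm Z_S S_X S_closed coeff.hyps that by blast
  ultimately show ?case
    using coeff.hyps
    by (intro exI[of _ "\<lambda>e. T1' (s e)"]) (auto split: if_splits intro: deg_le.coeff)
next
  case (var d T1)
  then obtain T1' where T1':
    "if d = 0 then T1' = (\<lambda>e. 0) else deg_le S Y (d - 1) T1'" "\<forall>e\<in>Q. X (T1 e) - T1 (X e) = T1' (Z e)"
    by blast
  have "X (T1 (Y e)) - T1 (Y (X e)) = T1' (Y (Z e)) + T1 (Z e)" if "e \<in> Q" for e
  proof -
    have "X (T1 (Y e)) - T1 (X (Y e)) = T1' (Y (Z e))"
      using T1'(2) that Y_closed S_Y Z_S by auto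
    moreover have "T1 (X (Y e)) - T1 (Y (X e)) = T1 (Z e)"
      using commutator[OF that] linear_diff[OF deg_le_linear[OF var.hyps]] by metis
    ultimately show ?thesis by (simp add: algebra_simps)
  qed
  moreover have "deg_le S Y d (\<lambda>e. T1' (Y e))"
  proof (cases d)
    case 0
    then show ?thesis using T1'(1) by (simp add: deg_le.zero)
  next
    case (Suc m)
    then show ?thesis using T1'(1) deg_le.var[of S Y m T1'] by simp
  qed
  ultimately show ?case
    using var.hyps by (intro exI[of _ "\<lambda>e. T1' (Y e) + T1 e"]) (auto intro: deg_le.add)
qed

text \<open>The exact coefficient matters here: it is what keeps the leading term of the iterated
  commutators non-zero.\<close>

lemma power_commutator:
  "e \<in> Q \<Longrightarrow> X ((Y ^^ Suc n) e) - (Y ^^ Suc n) (X e) = real (Suc n) *\<^sub>R (Y ^^ n) (Z e)"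
proof (induction n arbitrary: e)
  case 0
  then show ?case using commutator by simp
next
  case (Suc n)
  let ?P = "Y ^^ Suc n"
  have lin: "linear ?P" by (rule deg_le_linear[OF deg_le_power])
  have "X (?P (Y e)) - ?P (X (Y e)) = real (Suc n) *\<^sub>R (Y ^^ n) (Z (Y e))"
    using Suc.IH[of "Y e"] Suc.prems Y_closed by blast
  moreover have "(Y ^^ n) (Z (Y e)) = ?P (Z e)"
    using S_Y[OF Z_S Suc.prems] by (simp add: funpow_swap1)
  moreover have "?P (X (Y e)) - ?P (Y (X e)) = ?P (Z e)"
    using commutator[OF Suc.prems] linear_diff[OF lin] by metis
  moreover have "(Y ^^ Suc (Suc n)) a = ?P (Y a)" for a
    by (simp add: funpow_swap1)
  ultimately have "X ((Y ^^ Suc (Suc n)) e) - (Y ^^ Suc (Suc n)) (X e) = real (Suc n) *\<^sub>R ?P (Z e) + ?P (Z e)"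
    by (metis diff_add_cancel add_diff_eq)
  also have "\<dots> = real (Suc (Suc n)) *\<^sub>R ?P (Z e)"
    by (metis of_nat_Suc add.commute scaleR_left_distrib scaleR_one)
  finally show ?case .
qed

lemma Z_power_closed: "e \<in> Q \<Longrightarrow> (Z ^^ k) e \<in> Q"
  by (induction k) (auto simp: S_closed Z_S)

lemma Z_power_X: "e \<in> Q \<Longrightarrow> (Z ^^ k) (X e) = X ((Z ^^ k) e)"
  by (induction k) (auto simp: S_X Z_S Z_power_closed)

text \<open>Each commutator with \<open>X\<close> lowers the degree in \<open>Y\<close> by one, at the cost of a factor \<open>Z\<close>.\<close>

lemma Z_nilpotent_aux:
  assumes "c \<noteq> 0" "if n = 0 then R = (\<lambda>e. 0) else deg_le S Y (n - 1) R"
    and "\<And>e. e \<in> Q \<Longrightarrow> c *\<^sub>R (Y ^^ n) ((Z ^^ k) e) + R ((Z ^^ k) e) = 0"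
  shows "\<forall>e\<in>Q. (Z ^^ (n + k)) e = 0"
  using assms
proof (induction n arbitrary: c k R)
  case 0
  then show ?case by simp
next
  case (Suc n)
  have deg_R: "deg_le S Y n R" using Suc.prems(2) by simp
  obtain R' where R': "if n = 0 then R' = (\<lambda>e. 0) else deg_le S Y (n - 1) R'"
    "\<And>e. e \<in> Q \<Longrightarrow> X (R e) - R (X e) = R' (Z e)"
    using deg_le_commutator[OF deg_R] by blast
  \<comment> \<open>The relation at \<open>X e\<close> is subtracted from \<open>X\<close> applied
    to the relation at \<open>e\<close>. The leading coefficient picks up the factor
    \<open>Suc n\<close>, and the power of \<open>Z\<close> grows by one.\<close>
  have "(c * real (Suc n)) *\<^sub>R (Y ^^ n) ((Z ^^ Suc k) e) + R' ((Z ^^ Suc k) e) = 0"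
    if e: "e \<in> Q" for e
  proof -
    let ?a = "(Z ^^ k) e"
    have a: "?a \<in> Q" using e by (rule Z_power_closed)
    have "c *\<^sub>R (Y ^^ Suc n) (X ?a) + R (X ?a) = 0"
      using Suc.prems(3)[OF X_closed[OF e]] Z_power_X[OF e] by simp
    moreover have "c *\<^sub>R X ((Y ^^ Suc n) ?a) + X (R ?a) = X (c *\<^sub>R (Y ^^ Suc n) ?a + R ?a)"
      using linear_X by (simp only: linear_add linear_scale)
    then have "c *\<^sub>R X ((Y ^^ Suc n) ?a) + X (R ?a) = 0"
      using Suc.prems(3)[OF e] linear_X by (simp add: linear_0 del: funpow.simps)
    ultimately have "(c *\<^sub>R X ((Y ^^ Suc n) ?a) + X (R ?a)) - (c *\<^sub>R (Y ^^ Suc n) (X ?a) + R (X ?a)) = 0"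
      by simp
    then have "c *\<^sub>R (X ((Y ^^ Suc n) ?a) - (Y ^^ Suc n) (X ?a)) + (X (R ?a) - R (X ?a)) = 0"
      by (simp only: scaleR_diff_right add_diff_add)
    then show ?thesis
      unfolding power_commutator[OF a] R'(2)[OF a] by simp
  qed
  from Suc.IH[OF _ R'(1) this] Suc.prems(1) show ?case by simp
qed

lemma Z_nilpotent:
  assumes "monic S Y d P" "\<And>e. e \<in> Q \<Longrightarrow> P e = 0"
  shows "\<forall>e\<in>Q. (Z ^^ Suc d) e = 0"
proof -
  obtain R where "deg_le S Y d R" "P = (\<lambda>e. (Y ^^ Suc d) e + R e)"
    using assms(1) unfolding monic_def by blast
  then show ?thesis
    using Z_nilpotent_aux[of 1 "Suc d" R 0] assms(2) by (simp del: funpow.simps add: funpow_0)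
qed

end

section \<open>The J-maps and condition (C)\<close>

lemma M_type_bracket:
  assumes "M_type B q"
  shows "bilinear B" "B x y = - B y x" "span (range (\<lambda>(x,y). B x y)) = UNIV"
proof -
  have *: "bilinear B" "\<forall>x y. B x y = - B y x" "span (range (\<lambda>(x,y). B x y)) = UNIV"
    using assms unfolding M_type_def graded_2step_def by - (elim conjE, assumption)+
  show "bilinear B" by (rule *)
  show "B x y = - B y x" using *(2) by (elim allE)
  show "span (range (\<lambda>(x,y). B x y)) = UNIV" by (rule *)
qed

lemma M_type_form:
  assumes "M_type B q"
  shows "bilinear q" "q a b = q b a" "q (z, 0) (0, v) = 0" "(\<And>b. q a b = 0) \<Longrightarrow> a = 0"
proof -
  have *: "bilinear q" "\<forall>a b. q a b = q b a" "\<forall>z v. q (z, 0) (0, v) = 0"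
    "\<forall>a. (\<forall>b. q a b = 0) \<longrightarrow> a = 0"
    using assms unfolding M_type_def by - (elim conjE, assumption)+
  show "bilinear q" by (rule *)
  show "q a b = q b a" using *(2) by (elim allE)
  show "q (z, 0) (0, v) = 0" by (rule *(3)[rule_format])
  show "(\<And>b. q a b = 0) \<Longrightarrow> a = 0" by (rule *(4)[rule_format])
qed

text \<open>The two graded pieces are orthogonal, so a vector of degree -1 that is orthogonal to its
  own piece is orthogonal to the whole algebra.\<close>

lemma M_type_nondegenerate:
  fixes q :: "'z::real_vector \<times> 'v::real_vector \<Rightarrow> 'z \<times> 'v \<Rightarrow> real"
  assumes "M_type B q" "\<And>y. q (0, a) (0, y) = 0"
  shows "a = 0"
proof -
  note q = M_type_form[OF assms(1)]
  have "q (0, a) (z, y) = 0" for z y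
  proof -
    have "q (0, a) ((z, 0) + (0, y)) = q (0, a) (z, 0) + q (0, a) (0, y)"
      by (rule bilinear_radd[OF q(1)])
    moreover have "q (0, a) (z, 0) = 0" using q(3) by (subst q(2))
    ultimately show ?thesis using assms(2) by simp
  qed
  then have *: "q (0, a) b = 0" for b by (cases b) simp
  have "(0 :: 'z, a) = 0" by (rule q(4)) (rule *)
  then show ?thesis by (simp add: zero_prod_def)
qed

lemma M_type_linear:
  assumes "M_type B q"
  shows "linear (\<lambda>y. q a (0, y))" "linear (\<lambda>y. q (0, y) a)"
    "linear (\<lambda>z. q a (z, 0))" "linear (\<lambda>z. q (z, 0) a)"
proof -
  have q: "linear (q a)" "linear (\<lambda>b. q b a)" for a
    using M_type_form(1)[OF assms] unfolding bilinear_def by - (elim conjE, erule spec)+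
  have l: "linear (\<lambda>y::'a. (0::'b, y))" "linear (\<lambda>z::'b. (z, 0::'a))"
    by (auto intro: linearI)
  show "linear (\<lambda>y. q a (0, y))" "linear (\<lambda>y. q (0, y) a)"
    "linear (\<lambda>z. q a (z, 0))" "linear (\<lambda>z. q (z, 0) a)"
    using linear_compose[OF l(1) q(1)] linear_compose[OF l(1) q(2)]
      linear_compose[OF l(2) q(1)] linear_compose[OF l(2) q(2)] by (simp_all add: o_def)
qed

text \<open>\<open>Jmap\<close> is a definite description, so a map with the adjoint property must
  be shown to exist and to be unique. Both follow from non-degeneracy in degree -1, existence with
  the help of finite dimension.\<close>

lemma Jmap_adjoint:
  fixes B :: "'v::euclidean_space \<Rightarrow> 'v \<Rightarrow> 'z::real_vector"
  assumes M: "M_type B q"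
  shows "q (0, Jmap B q z x) (0, y) = q (z, 0) (B x y, 0)"
proof -
  note B = M_type_bracket[OF M] and lin = M_type_linear[OF M]
  \<comment> \<open>\<open>\<Phi> a\<close> lists the values of the functional represented by
    \<open>a\<close> on the basis. Injectivity forces surjectivity, so every linear functional on
    the piece of degree -1 is represented.\<close>
  define \<Phi> where "\<Phi> = (\<lambda>a. \<Sum>i\<in>Basis. q (0, a) (0, i) *\<^sub>R i)"
  have \<Phi>: "\<Phi> a \<bullet> i = q (0, a) (0, i)" if "i \<in> Basis" for a and i :: 'v
    using that by (simp add: \<Phi>_def)
  have "linear \<Phi>"
    unfolding \<Phi>_def
    by (rule linearI)
      (simp_all add: scaleR_left_distrib sum.distrib scaleR_sum_right linear_add[OF lin(2)] linear_scale[OF lin(2)])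
  have basis_eq: "f y = g y" if "linear f" "linear g" "\<And>i. i \<in> Basis \<Longrightarrow> f i = g i"
    for f g :: "'v \<Rightarrow> real" and y
    by (rule fun_cong[OF linear_eq_stdbasis[OF that]])
  have "inj \<Phi>"
  proof (subst linear_injective_0[OF \<open>linear \<Phi>\<close>], intro allI impI)
    fix a assume "\<Phi> a = 0"
    then have *: "q (0, a) (0, i) = 0" if "i \<in> Basis" for i
      using \<Phi>[OF that, of a] by simp
    have "q (0, a) (0, y) = 0" for y
      by (rule basis_eq[OF lin(1) linear_zero *])
    then show "a = 0" by (rule M_type_nondegenerate[OF M])
  qed
  then have "surj \<Phi>" using linear_injective_imp_surjective[OF \<open>linear \<Phi>\<close>] by blast
  have linB: "linear (\<lambda>y. q (z, 0) (B x y, 0))" for x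
  proof -
    have "linear (B x)" using B(1) unfolding bilinear_def by blast
    from linear_compose[OF this lin(3)] show ?thesis by (simp add: o_def)
  qed
  have "\<exists>a. \<forall>y. q (0, a) (0, y) = q (z, 0) (B x y, 0)" for x
  proof -
    let ?u = "\<Sum>i\<in>Basis. q (z, 0) (B x i, 0) *\<^sub>R i"
    obtain a where a: "?u = \<Phi> a"
      using \<open>surj \<Phi>\<close> by (rule surjE)
    have *: "q (0, a) (0, i) = q (z, 0) (B x i, 0)" if "i \<in> Basis" for i
    proof -
      have "?u \<bullet> i = q (z, 0) (B x i, 0)" using that by simp
      then show ?thesis using \<Phi>[OF that, of a] a by simp
    qed
    have "q (0, a) (0, y) = q (z, 0) (B x y, 0)" for y
      by (rule basis_eq[OF lin(1) linB *])
    then show ?thesis by blast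
  qed
  then obtain f where f: "\<forall>x y. q (0, f x) (0, y) = q (z, 0) (B x y, 0)"
    using choice[of "\<lambda>x a. \<forall>y. q (0, a) (0, y) = q (z, 0) (B x y, 0)"] by blast
  have "Jmap B q z = f"
    unfolding Jmap_def
  proof (rule the_equality[where P = "\<lambda>f. \<forall>x y. q (0, f x) (0, y) = q (z, 0) (B x y, 0)", OF f], rule ext)
    fix g x assume g: "\<forall>x y. q (0, g x) (0, y) = q (z, 0) (B x y, 0)"
    have "q (0, g x - f x) (0, y) = 0" for y
      by (simp only: linear_diff[OF lin(2)] f[rule_format] g[rule_format] diff_self)
    then show "g x = f x" using M_type_nondegenerate[OF M, of "g x - f x"] by simp
  qed
  then show ?thesis using f by simp
qed

lemma Jmap_linear:
  fixes B :: "'v::euclidean_space \<Rightarrow> 'v \<Rightarrow> 'z::real_vector"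
  assumes M: "M_type B q"
  shows "linear (Jmap B q z)"
proof -
  note B = M_type_bracket[OF M] and lin = M_type_linear[OF M]
  have eqI: "a = b" if "\<And>y. q (0, a) (0, y) = q (0, b) (0, y)" for a b
    using M_type_nondegenerate[OF M, of "a - b"] that linear_diff[OF lin(2)] by simp
  show ?thesis
  proof (rule linearI; rule eqI)
    show "q (0, Jmap B q z (b1 + b2)) (0, y) = q (0, Jmap B q z b1 + Jmap B q z b2) (0, y)" for b1 b2 y
      using linear_add[OF lin(2)] linear_add[OF lin(3)]
      by (simp only: Jmap_adjoint[OF M] bilinear_ladd[OF B(1)])
    show "q (0, Jmap B q z (r *\<^sub>R b)) (0, y) = q (0, r *\<^sub>R Jmap B q z b) (0, y)" for r b y
      using linear_scale[OF lin(2)] linear_scale[OF lin(3)]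
      by (simp only: Jmap_adjoint[OF M] bilinear_lmul[OF B(1)])
  qed
qed

text \<open>The indexed families are flattened to three vectors and three signs, the form in which
  the anticommutation of \<open>K\<close> and \<open>L\<close> is computed.\<close>

definition condition_C :: "('v::real_vector \<Rightarrow> 'v \<Rightarrow> 'z::real_vector)
    \<Rightarrow> ('z \<times> 'v \<Rightarrow> 'z \<times> 'v \<Rightarrow> real) \<Rightarrow> bool" where
  "condition_C B q \<longleftrightarrow> (\<exists>z1 z2 z3. \<exists>s12 s13 s23 :: real.
     (\<forall>z\<in>{z1, z2, z3}. \<forall>x. Jmap B q z x = 0 \<longrightarrow> x = 0)
   \<and> (\<forall>x. Jmap B q z1 (Jmap B q z2 x) = s12 *\<^sub>R Jmap B q z2 (Jmap B q z1 x))
   \<and> (\<forall>x. Jmap B q z1 (Jmap B q z3 x) = s13 *\<^sub>R Jmap B q z3 (Jmap B q z1 x))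
   \<and> (\<forall>x. Jmap B q z2 (Jmap B q z3 x) = s23 *\<^sub>R Jmap B q z3 (Jmap B q z2 x))
   \<and> {s12, s13, s23} \<subseteq> {-1, 1} \<and> s12 * s13 * s23 = -1)"

text \<open>As \<open>A\<close> is symmetric, \<open>A (K x) (L y)\<close> equals both \<open>K L (A x y)\<close> and \<open>L K (A x y)\<close>.\<close>

lemma symmetric_prolongation_zero:
  fixes B :: "'v::euclidean_space \<Rightarrow> 'v \<Rightarrow> 'z::real_vector"
  assumes M: "M_type B q" and C: "condition_C B q"
    and sym: "\<And>x y. A x y = A y x"
    and pre: "\<And>x a b. B (A x a) b = B (A x b) a"
  shows "A x y = 0"
proof -
  note B = M_type_bracket[OF M] and lin = M_type_linear[OF M]
  let ?J = "Jmap B q"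
  obtain z1 z2 z3 and s12 s13 s23 :: real where
    *: "\<forall>z\<in>{z1, z2, z3}. \<forall>x. ?J z x = 0 \<longrightarrow> x = 0"
      "\<forall>x. ?J z1 (?J z2 x) = s12 *\<^sub>R ?J z2 (?J z1 x)"
      "\<forall>x. ?J z1 (?J z3 x) = s13 *\<^sub>R ?J z3 (?J z1 x)"
      "\<forall>x. ?J z2 (?J z3 x) = s23 *\<^sub>R ?J z3 (?J z2 x)"
    and s: "{s12, s13, s23} \<subseteq> {-1, 1}" "s12 * s13 * s23 = -1"
    using C unfolding condition_C_def by (elim exE conjE)
  note inj = *(1)[rule_format] and J12 = *(2)[rule_format] and J13 = *(3)[rule_format]
    and J23 = *(4)[rule_format]
  have Jlin: "linear (?J z)" for z by (rule Jmap_linear[OF M])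
  have Jinj: "a = b" if "z \<in> {z1, z2, z3}" "?J z a = ?J z b" for z a b
    using inj[OF that(1), of "a - b"] that(2) linear_diff[OF Jlin] by simp
  have "inj (?J z1)" using Jinj by (auto simp: inj_def)
  then have "surj (?J z1)" using linear_injective_imp_surjective[OF Jlin] by blast
  then have right_inv: "?J z1 (inv (?J z1) a) = a" for a by (rule surj_f_inv_f)
  define K L where "K = (\<lambda>a. inv (?J z1) (?J z2 a))" and "L = (\<lambda>a. inv (?J z1) (?J z3 a))"
  then have K: "?J z1 (K a) = ?J z2 a" and L: "?J z1 (L a) = ?J z3 a" for a
    by (simp_all only: right_inv)
  \<comment> \<open>Let \<open>A^t\<close> be the adjoint of \<open>A x\<close>. Then
    \<open>swap\<close> and \<open>skew\<close> say that \<open>J A = - A^t J\<close> for every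
    J-map \<open>J\<close>. Hence \<open>J1 A H = - A^t J1 H = - A^t Jz = Jz A = J1 H A\<close>, and
    \<open>J1\<close> cancels.\<close>
  have comm: "A x (H a) = H (A x a)" if H: "\<And>a. ?J z1 (H a) = ?J z a" for H z x a
  proof -
    have swap: "q (0, ?J z' (A x a)) (0, b) = q (0, ?J z' (A x b)) (0, a)" for z' a b
      by (simp add: Jmap_adjoint[OF M] pre[of x a b])
    have skew: "q (0, ?J z' a) (0, b) = - q (0, ?J z' b) (0, a)" for z' a b
      using linear_neg[OF lin(3), of "(z', 0)" "B b a"]
      by (simp only: Jmap_adjoint[OF M] B(2)[of a b])
    have "q (0, ?J z1 (A x (H a))) (0, b) = q (0, ?J z (A x a)) (0, b)" for b
    proof -
      have "q (0, ?J z1 (A x (H a))) (0, b) = - q (0, ?J z1 (H a)) (0, A x b)"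
        using swap[of z1 "H a" b] skew[of z1 "A x b" "H a"] by simp
      also have "\<dots> = q (0, ?J z (A x b)) (0, a)" using skew[of z "A x b" a] by (simp add: H)
      finally show ?thesis using swap[of z a b] by simp
    qed
    then have "q (0, ?J z1 (A x (H a)) - ?J z (A x a)) (0, b) = 0" for b
      using linear_diff[OF lin(2)] by simp
    then have "?J z1 (A x (H a)) - ?J z (A x a) = 0" by (rule M_type_nondegenerate[OF M])
    then have "?J z1 (A x (H a)) = ?J z1 (H (A x a))" by (simp add: H)
    then show ?thesis using Jinj[of z1] by blast
  qed
  \<comment> \<open>Both products are brought to a multiple of \<open>?J z3 (?J z2 a)\<close>. The
    factors \<open>s12 * s23\<close> and \<open>s13\<close> are opposite signs, so \<open>K\<close>
    and \<open>L\<close> anticommute.\<close>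
  have KL: "?J z1 (?J z1 (K (L a))) = (s12 * s23) *\<^sub>R ?J z3 (?J z2 a)" for a
  proof -
    have "?J z1 (?J z1 (K (L a))) = s12 *\<^sub>R ?J z2 (?J z1 (L a))" by (simp add: K J12)
    then show ?thesis by (simp add: L J23)
  qed
  have LK: "?J z1 (?J z1 (L (K a))) = s13 *\<^sub>R ?J z3 (?J z2 a)" for a
  proof -
    have "?J z1 (?J z1 (L (K a))) = s13 *\<^sub>R ?J z3 (?J z1 (K a))" by (simp add: L J13)
    then show ?thesis by (simp add: K)
  qed
  have "A (K x) (L y) = L (K (A x y))"
    using comm[of L, OF L] comm[of K, OF K] sym by metis
  moreover have "A (K x) (L y) = K (L (A x y))"
    using comm[of L, OF L] comm[of K, OF K] sym by metis
  ultimately have "(s12 * s23) *\<^sub>R ?J z3 (?J z2 (A x y)) = s13 *\<^sub>R ?J z3 (?J z2 (A x y))"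
    using KL[of "A x y"] LK[of "A x y"] by metis
  moreover have "s12 * s23 \<noteq> s13" using s by auto
  ultimately have "?J z3 (?J z2 (A x y)) = 0" by simp
  then show ?thesis using inj by blast
qed

section \<open>Functions on words\<close>

text \<open>If \<open>e\<close> encodes \<open>u\<close>, then \<open>shift a e\<close> encodes
  \<open>[u, a]\<close>. Composition reverses the letters:
  \<open>shift a (shift b e) w = e (b # a # w)\<close>.\<close>

definition shift :: "'a \<Rightarrow> ('a list \<Rightarrow> 'b) \<Rightarrow> 'a list \<Rightarrow> 'b" where
  "shift a e = (\<lambda>w. e (a # w))"

lemma shift_apply [simp]: "shift a e w = e (a # w)"
  by (simp add: shift_def)

lemma linear_shift: "linear (shift a :: (_ \<Rightarrow> 'b::real_vector) \<Rightarrow> _)"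
  by (rule linearI) (auto simp: fun_eq_iff)

text \<open>An element of the prolongation is encoded by its values on words in \<open>\<nn>\<^sub>-\<^sub>1\<close> and \<open>\<nn>\<^sub>-\<^sub>2\<close>:
  \<open>e [a\<^sub>1, \<dots>, a\<^sub>r]\<close> is the component of \<open>[\<dots>[[u, a\<^sub>1], a\<^sub>2], \<dots>, a\<^sub>r]\<close> in degree -1.
  The last condition is the derivation property of the elements of degree 0 and 1.\<close>

definition word_functions ::
  "('v::real_vector \<Rightarrow> 'v \<Rightarrow> 'z::real_vector) \<Rightarrow> (('v + 'z) list \<Rightarrow> 'v) set" where
  "word_functions B = {e. \<forall>w v.
      linear (\<lambda>x. e (w @ Inl x # v)) \<and> linear (\<lambda>z. e (w @ Inr z # v))
    \<and> (\<forall>x y. e (w @ Inl x # Inl y # v) - e (w @ Inl y # Inl x # v) = e (w @ Inr (B x y) # v))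
    \<and> (\<forall>z x. e (w @ Inr z # Inl x # v) = e (w @ Inl x # Inr z # v))
    \<and> (\<forall>z z'. e (w @ Inr z # Inr z' # v) = e (w @ Inr z' # Inr z # v))
    \<and> (\<forall>x a b. B (e (w @ [Inl x, Inl a])) b - B (e (w @ [Inl x, Inl b])) a
        = B (e (w @ [Inr (B a b)])) x)}"

lemma word_functionsD:
  assumes "e \<in> word_functions B"
  shows "linear (\<lambda>x. e (w @ Inl x # v))" "linear (\<lambda>z. e (w @ Inr z # v))"
    "e (w @ Inl x # Inl y # v) - e (w @ Inl y # Inl x # v) = e (w @ Inr (B x y) # v)"
    "e (w @ Inr z # Inl x # v) = e (w @ Inl x # Inr z # v)"
    "e (w @ Inr z # Inr z' # v) = e (w @ Inr z' # Inr z # v)"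
    "B (e (w @ [Inl x, Inl a])) b - B (e (w @ [Inl x, Inl b])) a = B (e (w @ [Inr (B a b)])) x"
  using assms unfolding word_functions_def by auto

lemma word_functions_shift:
  assumes "e \<in> word_functions B"
  shows "shift a e \<in> word_functions B"
  unfolding word_functions_def
  using word_functionsD[OF assms, of "a # _"] by simp

lemma subspace_word_functions:
  assumes "bilinear B"
  shows "subspace (word_functions B)"
proof (rule subspaceI)
  show "0 \<in> word_functions B"
    using assms by (simp add: word_functions_def linear_zero bilinear_lzero)
next
  fix e f assume e: "e \<in> word_functions B" and f: "f \<in> word_functions B"
  have "(e + f) (w @ Inl x # Inl y # v) - (e + f) (w @ Inl y # Inl x # v)
      = (e + f) (w @ Inr (B x y) # v)" for w v x y
    using word_functionsD(3)[OF e, of w x y v] word_functionsD(3)[OF f, of w x y v]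
    by (simp add: algebra_simps)
  moreover have "B ((e + f) (w @ [Inl x, Inl a])) b - B ((e + f) (w @ [Inl x, Inl b])) a
      = B ((e + f) (w @ [Inr (B a b)])) x" for w x a b
    using word_functionsD(6)[OF e, of w x a b] word_functionsD(6)[OF f, of w x a b]
    by (simp add: bilinear_ladd[OF assms] algebra_simps)
  ultimately show "e + f \<in> word_functions B"
    unfolding word_functions_def
    using word_functionsD(1,2,4,5)[OF e] word_functionsD(1,2,4,5)[OF f]
    by (simp add: linear_compose_add)
next
  fix c e assume e: "e \<in> word_functions B"
  have "(c *\<^sub>R e) (w @ Inl x # Inl y # v) - (c *\<^sub>R e) (w @ Inl y # Inl x # v)
      = (c *\<^sub>R e) (w @ Inr (B x y) # v)" for w v x y
    using word_functionsD(3)[OF e, of w x y v] by (simp add: scaleR_diff_right[symmetric])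
  moreover have "B ((c *\<^sub>R e) (w @ [Inl x, Inl a])) b - B ((c *\<^sub>R e) (w @ [Inl x, Inl b])) a
      = B ((c *\<^sub>R e) (w @ [Inr (B a b)])) x" for w x a b
    using word_functionsD(6)[OF e, of w x a b]
    by (simp add: bilinear_lmul[OF assms] scaleR_diff_right[symmetric])
  ultimately show "c *\<^sub>R e \<in> word_functions B"
    unfolding word_functions_def
    using word_functionsD(1,2,4,5)[OF e]
    by (simp add: linear_compose_scale_right)
qed

section \<open>Finite generation of the dual over the central shifts, and nilpotency\<close>

lemma word_functions_zero:
  fixes B :: "'v::euclidean_space \<Rightarrow> 'v \<Rightarrow> 'z::real_vector"
  assumes M: "M_type B q" and C: "condition_C B q" and e: "e \<in> word_functions B"
    and "\<And>z. e [Inr z] = 0"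
  shows "e [Inl x, Inl y] = 0"
proof (rule symmetric_prolongation_zero[OF M C, where A = "\<lambda>x y. e [Inl x, Inl y]"])
  \<comment> \<open>Once \<open>e\<close> vanishes on single central letters, the commutator
    relation becomes symmetry, and the derivation property becomes the exchange of \<open>a\<close>
    and \<open>b\<close> under \<open>B\<close>.\<close>
  show "e [Inl x, Inl y] = e [Inl y, Inl x]" for x y
    using word_functionsD(3)[OF e, of "[]" x y "[]"] assms(4) by simp
  show "B (e [Inl x, Inl a]) b = B (e [Inl x, Inl b]) a" for x a b
    using word_functionsD(6)[OF e, of "[]" x a b] assms(4) bilinear_lzero[OF M_type_bracket(1)[OF M]]
    by simp
qed

text \<open>These read off the component of degree -1 and the action of the component of degree 0 on
  \<open>n_{-1}\<close>. They serve as module generators: higher degrees reduce to them through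
  central brackets.\<close>

definition coordinate_functionals :: "((('v::euclidean_space + 'z) list \<Rightarrow> 'v) \<Rightarrow> real) set" where
  "coordinate_functionals = (\<lambda>j e. e [] \<bullet> j) ` Basis
     \<union> (\<lambda>(i, j) e. e [Inl i] \<bullet> j) ` (Basis \<times> Basis)"

lemma finite_coordinate_functionals: "finite coordinate_functionals"
  by (simp add: coordinate_functionals_def)

lemma linear_evaluation: "linear (\<lambda>e :: 'a \<Rightarrow> 'b::euclidean_space. e w \<bullet> j)"
  by (rule linearI) (auto simp: inner_add_left)

lemma linear_coordinate_functionals: "f \<in> coordinate_functionals \<Longrightarrow> linear f"
  by (auto simp: coordinate_functionals_def linear_evaluation)

definition central_shifts :: "((('v + 'z) list \<Rightarrow> 'v) \<Rightarrow> ('v + 'z) list \<Rightarrow> 'v) set" where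
  "central_shifts = range (\<lambda>z. shift (Inr z))"

lemma commuting_shifts:
  fixes B :: "'v::real_vector \<Rightarrow> 'v \<Rightarrow> 'z::real_vector"
  assumes "bilinear B"
  shows "commuting_operators (word_functions B) central_shifts (shift (Inl y))"
proof (rule commuting_operators.intro)
  show "subspace (word_functions B)" by (rule subspace_word_functions[OF assms])
  show "linear (shift (Inl y) :: (('v + 'z) list \<Rightarrow> 'v) \<Rightarrow> _)" by (rule linear_shift)
next
  fix e assume e: "e \<in> word_functions B"
  then show "shift (Inl y) e \<in> word_functions B" by (rule word_functions_shift)
  fix s :: "(('v + 'z) list \<Rightarrow> 'v) \<Rightarrow> ('v + 'z) list \<Rightarrow> 'v" assume "s \<in> central_shifts"
  then obtain z where s: "s = shift (Inr z)" by (auto simp: central_shifts_def)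
  show "s e \<in> word_functions B" unfolding s using e by (rule word_functions_shift)
  show "s (shift (Inl y) e) = shift (Inl y) (s e)"
    unfolding s using word_functionsD(4)[OF e, of "[]" z y] by (simp add: fun_eq_iff)
  fix t :: "(('v + 'z) list \<Rightarrow> 'v) \<Rightarrow> ('v + 'z) list \<Rightarrow> 'v" assume "t \<in> central_shifts"
  then obtain z' where t: "t = shift (Inr z')" by (auto simp: central_shifts_def)
  show "s (t e) = t (s e)"
    unfolding s t using word_functionsD(5)[OF e, of "[]" z z'] by (simp add: fun_eq_iff)
next
  fix s :: "(('v + 'z) list \<Rightarrow> 'v) \<Rightarrow> ('v + 'z) list \<Rightarrow> 'v" assume "s \<in> central_shifts"
  then show "linear s" by (auto simp: central_shifts_def linear_shift)
qed

text \<open>As composing shifts reverses the letters, the shift by \<open>x\<close> takes the part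
  of \<open>Y\<close> and the shift by \<open>y\<close> that of \<open>X\<close>; this order gives
  \<open>B x y\<close> with the positive sign.\<close>

lemma heisenberg_shifts:
  fixes B :: "'v::real_vector \<Rightarrow> 'v \<Rightarrow> 'z::real_vector"
  assumes "bilinear B"
  shows "heisenberg_operators (word_functions B) central_shifts (shift (Inl x)) (shift (Inl y))
    (shift (Inr (B x y)))"
proof -
  interpret x: commuting_operators "word_functions B" central_shifts "shift (Inl x)"
    by (rule commuting_shifts[OF assms])
  interpret y: commuting_operators "word_functions B" central_shifts "shift (Inl y)"
    by (rule commuting_shifts[OF assms])
  show ?thesis
  proof (intro heisenberg_operators.intro heisenberg_operators_axioms.intro)
    show "commuting_operators (word_functions B) central_shifts (shift (Inl x))"
      by (rule commuting_shifts[OF assms])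
    show "linear (shift (Inl y) :: (('v + 'z) list \<Rightarrow> 'v) \<Rightarrow> _)" by (rule linear_shift)
    show "shift (Inr (B x y)) \<in> (central_shifts :: ((('v + 'z) list \<Rightarrow> 'v) \<Rightarrow> _) set)"
      by (simp add: central_shifts_def)
    show "shift (Inl y) (shift (Inl x) e) - shift (Inl x) (shift (Inl y) e) = shift (Inr (B x y)) e"
      if "e \<in> word_functions B" for e
      using word_functionsD(3)[OF that, of "[]" x y] by (simp add: fun_eq_iff)
  qed (auto intro: y.Y_closed y.S_Y)
qed

text \<open>Membership of \<open>f\<close>, restricted to \<open>Q\<close>, in the module spanned by
  \<open>F\<close> over the algebra generated by \<open>S\<close>. That algebra consists of the
  operators of degree 0 and acts on functionals by precomposition.\<close>

definition generated where
  "generated S Y Q F f \<longleftrightarrow> (\<exists>q. (\<forall>g\<in>F. deg_le S Y 0 (q g)) \<and> (\<forall>e\<in>Q. f e = (\<Sum>g\<in>F. g (q g e))))"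

lemma generated_base:
  fixes F :: "('e::real_vector \<Rightarrow> real) set"
  assumes "finite F" "\<And>g. g \<in> F \<Longrightarrow> linear g" "g \<in> F" "deg_le S Y 0 T"
  shows "generated S Y Q F (\<lambda>e. g (T e))"
proof -
  define q where "q = (\<lambda>h. if h = g then T else (\<lambda>e. 0))"
  have "(\<Sum>h\<in>F. h (q h e)) = (\<Sum>h\<in>F. if h = g then g (T e) else 0)" for e
    using assms(2) by (intro sum.cong) (auto simp: q_def linear_0)
  then show ?thesis
    unfolding generated_def using assms
    by (intro exI[of _ q]) (auto simp: q_def deg_le.zero)
qed

lemma generated_sum:
  fixes F :: "('e::real_vector \<Rightarrow> real) set"
  assumes "\<And>g. g \<in> F \<Longrightarrow> linear g" "finite I" "\<And>i. i \<in> I \<Longrightarrow> generated S Y Q F (f i)"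
  shows "generated S Y Q F (\<lambda>e. \<Sum>i\<in>I. c i * f i e)"
  using assms(2,3)
proof (induction I rule: finite_induct)
  case empty
  then show ?case
    unfolding generated_def using assms(1)
    by (intro exI[of _ "\<lambda>_ _. 0"]) (auto simp: linear_0 deg_le.zero)
next
  case (insert i I)
  then obtain q where q: "\<forall>g\<in>F. deg_le S Y 0 (q g)"
      "\<forall>e\<in>Q. (\<Sum>i\<in>I. c i * f i e) = (\<Sum>g\<in>F. g (q g e))"
    unfolding generated_def by auto
  obtain q' where q': "\<forall>g\<in>F. deg_le S Y 0 (q' g)" "\<forall>e\<in>Q. f i e = (\<Sum>g\<in>F. g (q' g e))"
    using insert.prems[of i] unfolding generated_def by auto
  have "(\<Sum>i\<in>insert i I. c i * f i e) = (\<Sum>g\<in>F. g (c i *\<^sub>R q' g e + q g e))" if "e \<in> Q" for e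
  proof -
    have "(\<Sum>g\<in>F. g (c i *\<^sub>R q' g e + q g e)) = (\<Sum>g\<in>F. c i * g (q' g e) + g (q g e))"
      using assms(1) by (intro sum.cong) (auto simp: linear_add linear_scale)
    then show ?thesis
      using insert.hyps q(2) q'(2) that by (simp add: sum.distrib sum_distrib_left)
  qed
  then show ?case
    unfolding generated_def using q(1) q'(1)
    by (intro exI[of _ "\<lambda>g e. c i *\<^sub>R q' g e + q g e"]) (auto intro!: deg_le.add[OF deg_le.scale])
qed

context
  fixes B :: "'v::euclidean_space \<Rightarrow> 'v \<Rightarrow> 'z::euclidean_space" and q
  assumes M: "M_type B q" and C: "condition_C B q"
begin

text \<open>Coordinates of \<open>e [Inl x]\<close> expand linearly in the generators. Those of
  \<open>e [Inl x, Inl i]\<close> vanish as soon as all \<open>e [Inr a]\<close> do, hence are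
  combinations of the coordinates of \<open>e [Inr a]\<close>, and these are generators precomposed
  with a central shift.\<close>

lemma generated_shift:
  assumes "f \<in> coordinate_functionals"
  shows "generated central_shifts Y (word_functions B) coordinate_functionals (\<lambda>e. f (shift (Inl x) e))"
proof -
  let ?F = "coordinate_functionals :: ((('v + 'z) list \<Rightarrow> 'v) \<Rightarrow> real) set"
  let ?gen = "generated central_shifts Y (word_functions B) ?F"
  have base: "?gen (\<lambda>e. g (T e))" if "g \<in> ?F" "deg_le central_shifts Y 0 T" for g T
    by (rule generated_base[OF finite_coordinate_functionals linear_coordinate_functionals that])
  from assms consider (val) j where "j \<in> Basis" "f = (\<lambda>e. e [] \<bullet> j)"
    | (der) i j where "i \<in> Basis" "j \<in> Basis" "f = (\<lambda>e. e [Inl i] \<bullet> j)"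
    unfolding coordinate_functionals_def by auto
  then show ?thesis
  proof cases
    case val
    have mem: "(\<lambda>e. e [Inl i] \<bullet> j) \<in> ?F" if "i \<in> Basis" for i
      using that val by (auto simp: coordinate_functionals_def)
    have "?gen (\<lambda>e. \<Sum>i\<in>Basis. (x \<bullet> i) * (e [Inl i] \<bullet> j))"
      using base[OF mem deg_le.ident]
      by (intro generated_sum[OF linear_coordinate_functionals]) auto
    moreover have "f (shift (Inl x) e) = (\<Sum>i\<in>Basis. (x \<bullet> i) * (e [Inl i] \<bullet> j))"
      if "e \<in> word_functions B" for e
    proof -
      have lin: "linear (\<lambda>x. e [Inl x])" using word_functionsD(1)[OF that, of "[]" "[]"] by simp
      have "e [Inl x] = e [Inl (\<Sum>i\<in>Basis. (x \<bullet> i) *\<^sub>R i)]" by (simp add: euclidean_representation)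
      also have "\<dots> = (\<Sum>i\<in>Basis. (x \<bullet> i) *\<^sub>R e [Inl i])"
        by (simp only: linear_sum[OF lin] linear_scale[OF lin])
      finally show ?thesis by (simp add: val inner_sum_left)
    qed
    ultimately show ?thesis unfolding generated_def by simp
  next
    case der
    define \<mu> where "\<mu> = (\<lambda>(a :: 'z, l :: 'v) (e :: ('v + 'z) list \<Rightarrow> 'v). e [Inr a] \<bullet> l)"
    have "\<exists>c. \<forall>e\<in>word_functions B. e [Inl x, Inl i] \<bullet> j = (\<Sum>p\<in>Basis \<times> Basis. c p * \<mu> p e)"
    proof (rule functional_combination)
      show "subspace (word_functions B)"
        by (rule subspace_word_functions[OF M_type_bracket(1)[OF M]])
      fix e assume e: "e \<in> word_functions B" and "\<forall>p\<in>Basis \<times> Basis. \<mu> p e = 0"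
      then have zero: "e [Inr a] = 0" if "a \<in> Basis" for a
        using that by (auto simp: \<mu>_def intro!: euclidean_eqI[of "e [Inr a]" 0])
      have "linear (\<lambda>z. e [Inr z])" using word_functionsD(2)[OF e, of "[]" "[]"] by simp
      from linear_eq_stdbasis[OF this linear_zero zero] have "e [Inr z] = 0" for z
        by (rule fun_cong)
      then show "e [Inl x, Inl i] \<bullet> j = 0" using word_functions_zero[OF M C e] by simp
    qed (auto simp: \<mu>_def linear_evaluation)
    then obtain c where c:
      "\<And>e. e \<in> word_functions B \<Longrightarrow> e [Inl x, Inl i] \<bullet> j = (\<Sum>p\<in>Basis \<times> Basis. c p * \<mu> p e)"
      by blast
    have "?gen (\<mu> p)" if p_in: "p \<in> Basis \<times> Basis" for p
    proof -
      obtain a l where p: "p = (a, l)" "l \<in> Basis" using p_in by auto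
      have mem: "(\<lambda>e. e [] \<bullet> l) \<in> ?F" using p by (auto simp: coordinate_functionals_def)
      have "deg_le central_shifts Y 0 (shift (Inr a))"
        by (rule deg_le.coeff[OF deg_le.ident]) (simp add: central_shifts_def)
      from base[OF mem this] show ?thesis by (simp add: \<mu>_def p)
    qed
    then have "?gen (\<lambda>e. \<Sum>p\<in>Basis \<times> Basis. c p * \<mu> p e)"
      by (intro generated_sum[OF linear_coordinate_functionals]) auto
    then show ?thesis using c unfolding generated_def der by simp
  qed
qed

text \<open>The vanishing hypothesis passes from \<open>e\<close> to \<open>shift a e\<close>: a
  central letter is absorbed into \<open>T\<close>, and a letter of degree -1 is removed by
  \<open>generated_shift\<close>. At the end only the empty word has to be read.\<close>

lemma word_functions_determined:
  assumes "e \<in> word_functions B"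
    and "\<And>T f. deg_le central_shifts Y 0 T \<Longrightarrow> f \<in> coordinate_functionals \<Longrightarrow> f (T e) = 0"
  shows "e w = 0"
  using assms
proof (induction w arbitrary: e)
  case Nil
  show ?case
  proof (rule euclidean_eqI)
    fix j :: 'v assume "j \<in> Basis"
    then have "(\<lambda>e. e [] \<bullet> j) \<in> coordinate_functionals"
      by (simp add: coordinate_functionals_def)
    from Nil.prems(2)[OF deg_le.ident this] show "e [] \<bullet> j = 0 \<bullet> j" by simp
  qed
next
  case (Cons a w)
  note e = Cons.prems(1) and zero = Cons.prems(2)
  have "f (T (shift a e)) = 0"
    if T: "deg_le central_shifts Y 0 T" and f: "f \<in> coordinate_functionals" for T f
  proof (cases a)
    case (Inr z)
    then have "deg_le central_shifts Y 0 (\<lambda>e. T (shift a e))"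
      by (intro deg_le.coeff[OF T]) (simp add: central_shifts_def)
    from zero[OF this f] show ?thesis .
  next
    case (Inl x)
    interpret commuting_operators "word_functions B" central_shifts "shift (Inl x)"
      by (rule commuting_shifts[OF M_type_bracket(1)[OF M]])
    have T': "deg_le central_shifts (shift (Inl x)) 0 T"
      using T by (rule deg_le_0_indep) simp
    obtain r where r: "\<forall>g\<in>coordinate_functionals. deg_le central_shifts (shift (Inl x)) 0 (r g)"
      "\<forall>e\<in>word_functions B. f (shift (Inl x) e) = (\<Sum>g\<in>coordinate_functionals. g (r g e))"
      using generated_shift[OF f] unfolding generated_def by blast
    have "f (T (shift a e)) = (\<Sum>g\<in>coordinate_functionals. g (r g (T e)))"
      using r(2) deg_le_closed[OF T' e] deg_le_Y[OF T' e] Inl by simp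
    also have "\<dots> = 0"
    proof (intro sum.neutral ballI)
      fix g :: "(('v + 'z) list \<Rightarrow> 'v) \<Rightarrow> real" assume g: "g \<in> coordinate_functionals"
      have "deg_le central_shifts (shift (Inl x)) 0 (\<lambda>e. r g (T e))"
        using deg_le_compose[of 0 "r g" 0 T] r(1) g T' by simp
      then have "deg_le central_shifts Y 0 (\<lambda>e. r g (T e))" by (rule deg_le_0_indep) simp
      from zero[OF this g] show "g (r g (T e)) = 0" .
    qed
    finally show ?thesis .
  qed
  then have "shift a e w = 0" by (rule Cons.IH[OF word_functions_shift[OF e]])
  then show ?case by simp
qed

text \<open>On the finitely many generators, \<open>shift (Inl x)\<close> acts by a matrix over the
  algebra of central shifts. It therefore satisfies a monic equation, and the Heisenberg relation
  with \<open>shift (Inl y)\<close> makes the bracket nilpotent. The exponent is uniform in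
  \<open>e\<close>.\<close>

lemma bracket_shift_nilpotent:
  "\<exists>r. \<forall>e\<in>word_functions B. (shift (Inr (B x y)) ^^ r) e = 0"
proof -
  interpret heisenberg_operators "word_functions B" central_shifts "shift (Inl x)" "shift (Inl y)"
    "shift (Inr (B x y))"
    by (rule heisenberg_shifts[OF M_type_bracket(1)[OF M]])
  let ?F = "coordinate_functionals :: ((('v + 'z) list \<Rightarrow> 'v) \<Rightarrow> real) set"
  let ?Y = "shift (Inl x) :: (('v + 'z) list \<Rightarrow> 'v) \<Rightarrow> _"
  have "\<forall>f\<in>?F. \<exists>p. (\<forall>g\<in>?F. deg_le central_shifts ?Y 0 (p g))
      \<and> (\<forall>e\<in>word_functions B. f (?Y e) = (\<Sum>g\<in>?F. g (p g e)))"
    using generated_shift unfolding generated_def by blast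
  from bchoice[OF this] obtain p where
    p: "\<And>f g. f \<in> ?F \<Longrightarrow> g \<in> ?F \<Longrightarrow> deg_le central_shifts ?Y 0 (p f g)"
    "\<And>f e. f \<in> ?F \<Longrightarrow> e \<in> word_functions B \<Longrightarrow> f (?Y e) = (\<Sum>g\<in>?F. g (p f g e))"
    by blast
  \<comment> \<open>Index 0 means degree 1: the initial relations have \<open>?Y\<close> itself on
    the left.\<close>
  have "monic central_shifts ?Y 0 ?Y"
    unfolding monic_def by (intro exI[of _ "\<lambda>e. 0"]) (auto intro: deg_le.zero)
  from monic_annihilator[OF finite_coordinate_functionals _ this, of "\<lambda>f. f" p]
  obtain d P where P: "monic central_shifts ?Y d P"
    "\<And>f e. f \<in> ?F \<Longrightarrow> e \<in> word_functions B \<Longrightarrow> f (P e) = 0"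
    using p linear_coordinate_functionals by blast
  note deg_P = monic_deg_le[OF P(1)]
  \<comment> \<open>Operators of degree 0 commute with \<open>P\<close>, so every generator vanishes
    at \<open>T (P e)\<close>, and generators detect zero.\<close>
  have "P e = 0" if e: "e \<in> word_functions B" for e
  proof
    fix w
    have "f (T (P e)) = 0" if T: "deg_le central_shifts ?Y 0 T" and f: "f \<in> ?F" for T f
      using P(2)[OF f deg_le_closed[OF T e]] deg_le_comm[OF T deg_P e] by simp
    then have "P e w = 0" by (rule word_functions_determined[OF deg_le_closed[OF deg_P e]])
    then show "P e w = 0 w" by simp
  qed
  from Z_nilpotent[OF P(1) this] show ?thesis by blast
qed

section \<open>A uniform bound on the length of words with non-zero value\<close>

lemma word_functions_move_central:
  "e \<in> word_functions B \<Longrightarrow> e (w @ Inr z # v) = e (Inr z # w @ v)"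
proof (induction w arbitrary: e)
  case (Cons a w)
  have "e (a # w @ Inr z # v) = e (a # Inr z # w @ v)"
    using Cons.IH[OF word_functions_shift[OF Cons.prems], of a] by simp
  also have "\<dots> = e (Inr z # a # w @ v)"
    using word_functionsD(4,5)[OF Cons.prems, of "[]"] by (cases a) simp_all
  finally show ?case by simp
qed simp

lemma word_functions_append:
  "e \<in> word_functions B \<Longrightarrow> (\<lambda>v. e (w @ v)) \<in> word_functions B"
proof (induction w arbitrary: e)
  case (Cons a w)
  then show ?case using Cons.IH[OF word_functions_shift, of e a] by simp
qed simp

text \<open>A central letter anywhere can be moved to the front and kills the value. If the last two
  letters both have degree -1, the rest \<open>u\<close> of the word is absorbed, since
  \<open>e (u @ v)\<close> is again a word function of \<open>v\<close>, and
  \<open>word_functions_zero\<close> applies.\<close>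

lemma word_functions_vanish_two:
  assumes e: "e \<in> word_functions B" and zero: "\<And>z. shift (Inr z) e = 0" and "length w \<ge> 2"
  shows "e w = 0"
proof -
  define u where "u = take (length w - 2) w"
  have "length (drop (length w - 2) w) = 2" using assms(3) by simp
  then obtain a b where "drop (length w - 2) w = [a, b]"
    by (metis (no_types) length_0_conv length_Suc_conv numeral_2_eq_2)
  then have w: "w = u @ [a, b]" unfolding u_def by (metis append_take_drop_id)
  have central: "e (v @ Inr z # v') = 0" for v z v'
    using zero[of z] by (simp add: word_functions_move_central[OF e] fun_eq_iff)
  show ?thesis
  proof (cases a)
    case (Inr z)
    then show ?thesis using central[of u z "[b]"] by (simp add: w)
  next
    case (Inl x)
    show ?thesis
    proof (cases b)
      case (Inr z)
      then show ?thesis using central[of "u @ [a]" z "[]"] by (simp add: w)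
    next
      case (Inl y)
      have "e (u @ [Inl x, Inl y]) = 0"
        using word_functions_zero[OF M C word_functions_append[OF e, of u]] central[of u _ "[]"] by simp
      then show ?thesis by (simp add: w \<open>a = Inl x\<close> Inl)
    qed
  qed
qed

text \<open>Nilpotency of the central shifts along a basis of brackets, used one basis vector at a
  time: a long enough initial segment of the word kills the action of \<open>b\<close>.\<close>

lemma word_functions_vanish_partial:
  assumes "finite F" "F \<subseteq> bs" "bs \<subseteq> range (\<lambda>(x, y). B x y)" "span bs = UNIV"
  shows "\<exists>c. \<forall>e\<in>word_functions B. (\<forall>b\<in>bs - F. shift (Inr b) e = 0) \<longrightarrow> (\<forall>w. length w \<ge> c \<longrightarrow> e w = 0)"
  using assms(1,2)
proof (induction F rule: finite_induct)
  case empty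
  have "e w = 0" if e: "e \<in> word_functions B" and "\<forall>b\<in>bs. shift (Inr b) e = 0" and "length w \<ge> 2" for e w
  proof (rule word_functions_vanish_two[OF e _ \<open>length w \<ge> 2\<close>])
    show "shift (Inr z) e = 0" for z
    proof
      fix v
      have "linear (\<lambda>z. e (Inr z # v))" using word_functionsD(2)[OF e, of "[]"] by simp
      moreover have "e (Inr b # v) = 0" if "b \<in> bs" for b
        using \<open>\<forall>b\<in>bs. shift (Inr b) e = 0\<close> that by (auto simp: fun_eq_iff)
      ultimately show "shift (Inr z) e v = 0 v"
        using linear_eq_0_on_span[of "\<lambda>z. e (Inr z # v)" bs z] assms(4) by simp
    qed
  qed
  then show ?case by (intro exI[of _ 2]) blast
next
  case (insert b F)
  then obtain c where c: "\<And>e w. e \<in> word_functions B \<Longrightarrow> (\<forall>b\<in>bs - F. shift (Inr b) e = 0)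
      \<Longrightarrow> length w \<ge> c \<Longrightarrow> e w = 0"
    by blast
  \<comment> \<open>Here \<open>r\<close> is the nilpotency exponent of \<open>b\<close> on the
    given \<open>e\<close>; each power of \<open>b\<close> costs one more block of \<open>c\<close>
    letters.\<close>
  have step: "\<forall>e\<in>word_functions B. (shift (Inr b) ^^ r) e = 0
      \<longrightarrow> (\<forall>b'\<in>bs - insert b F. shift (Inr b') e = 0) \<longrightarrow> (\<forall>w. length w \<ge> r * c \<longrightarrow> e w = 0)" for r
  proof (induction r)
    case 0
    then show ?case by simp
  next
    case (Suc r)
    show ?case
    proof (intro ballI impI allI)
      fix e and w :: "('v + 'z) list"
      assume e: "e \<in> word_functions B" and nil: "(shift (Inr b) ^^ Suc r) e = 0"
        and zero: "\<forall>b'\<in>bs - insert b F. shift (Inr b') e = 0" and "length w \<ge> Suc r * c"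
      have "(shift (Inr b) ^^ r) (shift (Inr b) e) = 0"
        using nil by (simp only: funpow_Suc_right o_def)
      moreover have "\<forall>b'\<in>bs - insert b F. shift (Inr b') (shift (Inr b) e) = 0"
      proof (intro ballI ext)
        fix b' v assume "b' \<in> bs - insert b F"
        with zero have "shift (Inr b') e = 0" by blast
        from fun_cong[OF this, of "Inr b # v"] have "e (Inr b' # Inr b # v) = 0" by simp
        then show "shift (Inr b') (shift (Inr b) e) v = 0 v"
          using word_functionsD(5)[OF e, of "[]" b b' v] by simp
      qed
      ultimately have "\<forall>w. length w \<ge> r * c \<longrightarrow> shift (Inr b) e w = 0"
        using Suc.IH word_functions_shift[OF e, of "Inr b"] by blast
      then have long: "e (Inr b # w) = 0" if "length w \<ge> r * c" for w using that by simp
      \<comment> \<open>By induction \<open>shift (Inr b) e\<close> vanishes on words of length at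
        least \<open>r * c\<close>. After the prefix \<open>u\<close> has been read, the remaining
        function is thus killed by \<open>b\<close> as well, and the bound \<open>c\<close> applies
        to \<open>v\<close>.\<close>
      define u where "u = take (r * c) w"
      define v where "v = drop (r * c) w"
      have len: "length u = r * c" "length v \<ge> c" and w: "w = u @ v"
        using \<open>length w \<ge> Suc r * c\<close> by (auto simp: u_def v_def)
      have "\<forall>b'\<in>bs - F. shift (Inr b') (\<lambda>v. e (u @ v)) = 0"
      proof (intro ballI ext)
        fix b' v' assume b': "b' \<in> bs - F"
        have "e (Inr b' # u @ v') = 0"
        proof (cases "b' = b")
          case True
          then show ?thesis using long[of "u @ v'"] len(1) by simp
        next
          case False
          with b' zero have "shift (Inr b') e = 0" by blast
          from fun_cong[OF this, of "u @ v'"] show ?thesis by simp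
        qed
        then show "shift (Inr b') (\<lambda>v. e (u @ v)) v' = 0 v'"
          by (simp add: word_functions_move_central[OF e])
      qed
      from c[OF word_functions_append[OF e] this len(2)] show "e w = 0" by (simp add: w)
    qed
  qed
  have "b \<in> range (\<lambda>(x, y). B x y)" using insert.prems assms(3) by blast
  then obtain x y where b: "b = B x y" by auto
  obtain r where r: "\<forall>e\<in>word_functions B. (shift (Inr b) ^^ r) e = 0"
    using bracket_shift_nilpotent[of x y] unfolding b by (elim exE)
  show ?case
  proof (intro exI[of _ "r * c"] ballI impI allI)
    fix e and w :: "('v + 'z) list"
    assume e: "e \<in> word_functions B" and zero: "\<forall>b'\<in>bs - insert b F. shift (Inr b') e = 0"
      and len: "length w \<ge> r * c"
    show "e w = 0"
      by (rule step[THEN bspec, OF e, THEN mp, THEN mp, THEN spec, THEN mp,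
            OF r[THEN bspec, OF e] zero len])
  qed
qed

lemma word_functions_vanish: "\<exists>c. \<forall>e\<in>word_functions B. \<forall>w. length w \<ge> c \<longrightarrow> e w = 0"
proof -
  obtain bs where bs: "bs \<subseteq> range (\<lambda>(x, y). B x y)" "independent bs"
    "range (\<lambda>(x, y). B x y) \<subseteq> span bs"
    by (rule basis_exists)
  have "span (range (\<lambda>(x, y). B x y)) \<subseteq> span bs"
    using bs(3) by (rule span_minimal) (rule subspace_span)
  then have "span bs = UNIV" using M_type_bracket(3)[OF M] by (simp only: top_unique)
  \<comment> \<open>With \<open>F = bs\<close> no condition on \<open>e\<close> remains.\<close>
  from word_functions_vanish_partial[OF independent_imp_finite[OF bs(2)] subset_refl bs(1) this]
  show ?thesis by (simp only: Diff_cancel Ball_def empty_iff simp_thms)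
qed

end

section \<open>Evaluation of the prolongation on words\<close>

text \<open>Only degree -1 is read and all other degrees give 0, so a word detects a homogeneous
  element only if its weight brings that element down exactly to degree -1.\<close>

primrec tel_value :: "('v::real_vector, 'z::real_vector) tel \<Rightarrow> 'v" where
  "tel_value (TZ a) = 0"
| "tel_value (TV a) = a"
| "tel_value (TP f g) = 0"

primrec eval_word :: "('v::real_vector \<Rightarrow> 'v \<Rightarrow> 'z::real_vector) \<Rightarrow> ('v + 'z) list \<Rightarrow> ('v, 'z) tel \<Rightarrow> 'v" where
  "eval_word B [] u = tel_value u"
| "eval_word B (a # w) u = eval_word B w (case a of Inl x \<Rightarrow> brV B u x | Inr z \<Rightarrow> brZ u z)"

text \<open>\<open>tadd\<close> is only meaningful for elements of the same degree.\<close>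

fun of_degree :: "nat \<Rightarrow> ('v, 'z) tel \<Rightarrow> bool" where
  "of_degree 0 u = (\<exists>a. u = TZ a)"
| "of_degree (Suc 0) u = (\<exists>a. u = TV a)"
| "of_degree (Suc (Suc n)) u = (\<exists>f g. u = TP f g \<and> (\<forall>x. of_degree (Suc n) (f x)) \<and> (\<forall>z. of_degree n (g z)))"

lemma tanaka_of_degree: "u \<in> tanaka B d \<Longrightarrow> of_degree d u"
  by (induction B d arbitrary: u rule: tanaka.induct) auto

text \<open>Truncated subtraction agrees with the convention that a bracket falling below degree -2
  is \<open>TZ 0\<close>, an element of index 0.\<close>

lemma of_degree_brV: "of_degree d u \<Longrightarrow> of_degree (d - 1) (brV B u x)"
  by (cases d rule: tzero.cases) auto

lemma of_degree_brZ: "of_degree d u \<Longrightarrow> of_degree (d - 2) (brZ u z)"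
  by (cases d rule: tzero.cases) auto

lemma of_degree_tscale: "of_degree d u \<Longrightarrow> of_degree d (tscale c u)"
  by (induction d u rule: of_degree.induct) auto

lemma brV_tadd:
  "bilinear B \<Longrightarrow> of_degree d u \<Longrightarrow> of_degree d v \<Longrightarrow> brV B (tadd u v) x = tadd (brV B u x) (brV B v x)"
  by (cases d rule: tzero.cases) (auto simp: bilinear_ladd)

lemma brZ_tadd:
  "of_degree d u \<Longrightarrow> of_degree d v \<Longrightarrow> brZ (tadd u v) z = tadd (brZ u z) (brZ v z)"
  by (cases d rule: tzero.cases) auto

lemma brV_tscale: "bilinear B \<Longrightarrow> brV B (tscale c u) x = tscale c (brV B u x)"
  by (cases u) (auto simp: bilinear_lmul)

lemma brZ_tscale: "brZ (tscale c u) z = tscale c (brZ u z)"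
  by (cases u) auto

lemma eval_word_tadd:
  assumes "bilinear B"
  shows "of_degree d u \<Longrightarrow> of_degree d v \<Longrightarrow> eval_word B w (tadd u v) = eval_word B w u + eval_word B w v"
proof (induction w arbitrary: d u v)
  case Nil
  then show ?case by (cases d rule: tzero.cases) auto
next
  case (Cons a w)
  then show ?case
    using Cons.IH[OF of_degree_brV of_degree_brV] Cons.IH[OF of_degree_brZ of_degree_brZ]
    by (cases a) (simp_all add: brV_tadd[OF assms Cons.prems] brZ_tadd[OF Cons.prems])
qed

lemma eval_word_tscale:
  assumes "bilinear B"
  shows "eval_word B w (tscale c u) = c *\<^sub>R eval_word B w u"
proof (induction w arbitrary: u)
  case Nil
  then show ?case by (cases u) auto
next
  case (Cons a w)
  then show ?case by (cases a) (simp_all add: brV_tscale[OF assms] brZ_tscale)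
qed

lemma eval_word_TZ [simp]: "eval_word B w (TZ a) = 0"
  by (induction w arbitrary: a) (auto split: sum.split)

lemma eval_word_TV_Cons [simp]: "eval_word B (a # w) (TV b) = 0"
  by (cases a) auto

lemma tanaka_SucSucE:
  assumes "u \<in> tanaka B (Suc (Suc n))"
  obtains f g where "u = TP f g" "\<And>x. f x \<in> tanaka B (Suc n)" "\<And>z. g z \<in> tanaka B n"
    "\<And>x y. f (x + y) = tadd (f x) (f y)" "\<And>c x. f (c *\<^sub>R x) = tscale c (f x)"
    "\<And>z w. g (z + w) = tadd (g z) (g w)" "\<And>c z. g (c *\<^sub>R z) = tscale c (g z)"
    "\<And>x y. g (B x y) = tadd (brV B (f x) y) (tscale (-1) (brV B (f y) x))"
    "\<And>x z. brZ (f x) z = brV B (g z) x" "\<And>z w. brZ (g z) w = brZ (g w) z"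
  using assms by auto

lemma tanaka_brV: "u \<in> tanaka B d \<Longrightarrow> brV B u x \<in> tanaka B (d - 1)"
  by (cases d rule: tzero.cases) auto

lemma tanaka_brZ: "u \<in> tanaka B d \<Longrightarrow> brZ u z \<in> tanaka B (d - 2)"
  by (cases d rule: tzero.cases) auto

text \<open>It suffices to treat the beginning of a word, because a prefix only replaces
  \<open>u\<close> by another element of the prolongation.\<close>

lemma eval_word_head_relations:
  assumes "bilinear B" "u \<in> tanaka B d"
  shows "linear (\<lambda>x. eval_word B (Inl x # v) u)" (is ?lV)
    and "linear (\<lambda>z. eval_word B (Inr z # v) u)" (is ?lZ)
    and "eval_word B (Inl x # Inl y # v) u - eval_word B (Inl y # Inl x # v) u
      = eval_word B (Inr (B x y) # v) u" (is ?comm)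
    and "eval_word B (Inr z # Inl x # v) u = eval_word B (Inl x # Inr z # v) u" (is ?ZV)
    and "eval_word B (Inr z # Inr z' # v) u = eval_word B (Inr z' # Inr z # v) u" (is ?ZZ)
    and "B (eval_word B [Inl x, Inl a] u) b - B (eval_word B [Inl x, Inl b] u) a
      = B (eval_word B [Inr (B a b)] u) x" (is ?der)
proof -
  have "?lV \<and> ?lZ \<and> ?comm \<and> ?ZV \<and> ?ZZ \<and> ?der"
  proof (cases "d < 2")
    case True
    then have "(\<exists>a. u = TZ a) \<or> (\<exists>a. u = TV a)"
      using assms(2) by (auto simp: less_2_cases_iff)
    then show ?thesis
      using assms(1) by (auto simp: linear_zero bilinear_lzero)
  next
    case False
    then obtain n where d: "d = Suc (Suc n)" by (metis add_2_eq_Suc le_Suc_ex not_less)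
    obtain f g where u: "u = TP f g" and f: "\<And>x. f x \<in> tanaka B (Suc n)" and g: "\<And>z. g z \<in> tanaka B n"
      and lin: "\<And>x y. f (x + y) = tadd (f x) (f y)" "\<And>c x. f (c *\<^sub>R x) = tscale c (f x)"
      "\<And>z w. g (z + w) = tadd (g z) (g w)" "\<And>c z. g (c *\<^sub>R z) = tscale c (g z)"
      and comm: "\<And>x y. g (B x y) = tadd (brV B (f x) y) (tscale (-1) (brV B (f y) x))"
      and central: "\<And>x z. brZ (f x) z = brV B (g z) x" "\<And>z w. brZ (g z) w = brZ (g w) z"
      using assms(2) unfolding d by (elim tanaka_SucSucE) blast
    note deg_f = tanaka_of_degree[OF f] and deg_g = tanaka_of_degree[OF g]
    note tadd = eval_word_tadd[OF assms(1)] and tscale = eval_word_tscale[OF assms(1)]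
    have deg_fx: "of_degree n (brV B (f x) y)" for x y
      using of_degree_brV[OF deg_f] by simp
    have ?lV by (rule linearI) (simp_all add: u lin tadd[OF deg_f deg_f] tscale)
    moreover have ?lZ by (rule linearI) (simp_all add: u lin tadd[OF deg_g deg_g] tscale)
    moreover have ?comm
      by (simp add: u comm tadd[OF deg_fx of_degree_tscale[OF deg_fx]] tscale)
    moreover have ?ZV by (simp add: u central)
    moreover have ?ZZ using central(2)[of z z'] by (simp add: u)
    moreover have ?der
    \<comment> \<open>Index \<open>Suc (Suc 1)\<close> is degree 1, the only degree
      \<open>\<ge> 0\<close> from which two letters of degree -1, or one of degree -2, lead to
      degree -1. There the identity is the derivation property of \<open>f x\<close>, which has
      degree 0, combined with \<open>[[u, x], z] = [[u, z], x]\<close>.\<close>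
    proof (cases "n = 1")
      case True
      have "f x \<in> tanaka B (Suc (Suc 0))" using f[of x] True by simp
      then obtain f' g' where f': "f x = TP f' g'" "\<And>y. f' y \<in> range TV"
        "\<And>a b. g' (B a b) = tadd (brV B (f' a) b) (tscale (-1) (brV B (f' b) a))"
        by (elim tanaka_SucSucE) auto
      obtain \<alpha> \<beta> where \<alpha>\<beta>: "f' a = TV \<alpha>" "f' b = TV \<beta>" using f'(2) by blast
      obtain c where c: "g (B a b) = TV c" using g[of "B a b"] True by auto
      have "TZ (B c x) = TZ (B \<alpha> b - B \<beta> a)"
        using central(1)[of x "B a b"] f'(3)[of a b] by (simp add: f'(1) \<alpha>\<beta> c)
      then show ?thesis by (simp add: u f'(1) \<alpha>\<beta> c)
    next
      case False
      have "tel_value (brV B (f x) y) = 0" "tel_value (g z) = 0" for x y z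
      proof -
        have *: "tel_value t = 0" if "of_degree n t" for t
          using that False by (cases n rule: tzero.cases) auto
        show "tel_value (brV B (f x) y) = 0" "tel_value (g z) = 0"
          using *[OF deg_fx] *[OF deg_g] by auto
      qed
      then show ?thesis using assms(1) by (simp add: u bilinear_lzero)
    qed
    ultimately show ?thesis by blast
  qed
  then show ?lV ?lZ ?comm ?ZV ?ZZ ?der by blast+
qed

lemma eval_word_append:
  "eval_word B (w @ v) u = eval_word B v (foldl (\<lambda>u. case_sum (brV B u) (brZ u)) u w)"
  by (induction w arbitrary: u) auto

lemma tanaka_foldl:
  "u \<in> tanaka B d \<Longrightarrow> \<exists>d'. foldl (\<lambda>u. case_sum (brV B u) (brZ u)) u w \<in> tanaka B d'"
proof (induction w arbitrary: u d)
  case (Cons a w)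
  have "\<exists>d'. case_sum (brV B u) (brZ u) a \<in> tanaka B d'"
    using tanaka_brV[OF Cons.prems] tanaka_brZ[OF Cons.prems] by (cases a) auto
  then show ?case using Cons.IH by auto
qed auto

lemma eval_word_word_functions:
  assumes "bilinear B" "u \<in> tanaka B d"
  shows "(\<lambda>w. eval_word B w u) \<in> word_functions B"
proof -
  have "\<exists>u' d'. u' \<in> tanaka B d' \<and> (\<forall>v. eval_word B (w @ v) u = eval_word B v u')" for w
    using tanaka_foldl[OF assms(2), of w] eval_word_append by blast
  then obtain U D where U: "\<And>w. U w \<in> tanaka B (D w)"
    "\<And>w v. eval_word B (w @ v) u = eval_word B v (U w)"
    by metis
  show ?thesis
    unfolding word_functions_def mem_Collect_eq U(2)
    using eval_word_head_relations[OF assms(1) U(1)] by blast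
qed

section \<open>Zero elements and faithfulness of the evaluation on words\<close>

lemma tscale_tzero: "tscale c (tzero d) = tzero d"
  by (induction d rule: tzero.induct) auto

lemma tadd_tzero: "tadd (tzero d) (tzero d) = tzero d"
  by (induction d rule: tzero.induct) auto

lemma brV_tzero: "bilinear B \<Longrightarrow> brV B (tzero (Suc d)) x = tzero d"
  by (cases d) (auto simp: bilinear_lzero)

text \<open>\<open>rigid\<close> compares each piece with a singleton, so the vanishing of a piece
  includes that its zero element belongs to it.\<close>

lemma tzero_tanaka:
  assumes "bilinear B"
  shows "tzero d \<in> tanaka B d"
proof (induction d rule: induct_nat_012)
  case (ge2 n)
  have "brZ (tzero (Suc n) :: ('a, 'b) tel) z = brV B (tzero n) x" for x z
    using assms by (cases n rule: tzero.cases) (auto simp: bilinear_lzero)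
  moreover have "brZ (tzero n :: ('a, 'b) tel) z = brZ (tzero n) w" for z w
    by (cases n rule: tzero.cases) auto
  ultimately show ?case
    using ge2 brV_tzero[OF assms, of n] by (auto simp: tscale_tzero tadd_tzero)
qed auto

text \<open>An element of index \<open>Suc n\<close> reaches degree -1 after exactly
  \<open>n\<close> brackets with \<open>n_{-1}\<close>, so words of this length suffice. Induction
  makes \<open>f\<close> vanish; then \<open>g\<close> vanishes on brackets, and these span
  \<open>n_{-2}\<close>.\<close>

lemma eval_word_determines_tanaka:
  assumes "bilinear B" "span (range (\<lambda>(x, y). B x y)) = UNIV"
  shows "u \<in> tanaka B (Suc n) \<Longrightarrow> (\<And>xs. length xs = n \<Longrightarrow> eval_word B (map Inl xs) u = 0)
    \<Longrightarrow> u = tzero (Suc n)"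
proof (induction n arbitrary: u)
  case 0
  then show ?case using "0.prems"(2)[of "[]"] by auto
next
  case (Suc n)
  obtain f g where u: "u = TP f g" and f: "\<And>x. f x \<in> tanaka B (Suc n)"
    and g: "\<And>z w. g (z + w) = tadd (g z) (g w)" "\<And>c z. g (c *\<^sub>R z) = tscale c (g z)"
    and comm: "\<And>x y. g (B x y) = tadd (brV B (f x) y) (tscale (-1) (brV B (f y) x))"
    using Suc.prems(1) by (elim tanaka_SucSucE) blast
  have f0: "f x = tzero (Suc n)" for x
  proof (rule Suc.IH[OF f])
    show "eval_word B (map Inl xs) (f x) = 0" if "length xs = n" for xs
      using Suc.prems(2)[of "x # xs"] that by (simp add: u)
  qed
  have gB: "g (B x y) = tzero n" for x y
    by (simp add: comm f0 brV_tzero[OF assms(1)] tscale_tzero tadd_tzero)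
  have "g z = tzero n" for z
  proof -
    have "z \<in> span (range (\<lambda>(x, y). B x y))" using assms(2) by simp
    then show ?thesis
    proof (induction rule: span_induct_alt)
      case base
      show ?case using g(2)[of 0 "B 0 0"] by (simp add: gB tscale_tzero)
    next
      case (step c z w)
      then show ?case by (auto simp: g gB tscale_tzero tadd_tzero)
    qed
  qed
  then show ?case using f0 by (simp add: u fun_eq_iff)
qed

theorem theorem3p6:
  fixes B :: "'v::euclidean_space \<Rightarrow> 'v \<Rightarrow> 'z::euclidean_space"
    and q :: "'z \<times> 'v \<Rightarrow> 'z \<times> 'v \<Rightarrow> real"
  assumes "M_type B q"
    and "DIM('z) \<ge> 3"
    and "\<exists>(zz :: nat \<Rightarrow> 'z) (\<sigma> :: nat \<Rightarrow> nat \<Rightarrow> real).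
           inj_on zz {1,2,3} \<and> independent (zz ` {1,2,3})
         \<and> (\<forall>i\<in>{1,2,3}. \<forall>x. Jmap B q (zz i) x = 0 \<longrightarrow> x = 0)
         \<and> (\<forall>i\<in>{1,2,3}. \<forall>j\<in>{1,2,3}. \<sigma> i j \<in> {-1, 1}
              \<and> (\<forall>x. Jmap B q (zz i) (Jmap B q (zz j) x)
                     = \<sigma> i j *\<^sub>R Jmap B q (zz j) (Jmap B q (zz i) x)))
         \<and> \<sigma> 1 2 * \<sigma> 1 3 * \<sigma> 2 3 = -1"
  shows "rigid B"
proof -
  note B = M_type_bracket[OF assms(1)]
  obtain zz :: "nat \<Rightarrow> 'z" and \<sigma> :: "nat \<Rightarrow> nat \<Rightarrow> real" where
    inj: "\<forall>i\<in>{1,2,3}. \<forall>x. Jmap B q (zz i) x = 0 \<longrightarrow> x = 0"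
    and comm: "\<forall>i\<in>{1,2,3}. \<forall>j\<in>{1,2,3}. \<sigma> i j \<in> {-1, 1}
              \<and> (\<forall>x. Jmap B q (zz i) (Jmap B q (zz j) x)
                     = \<sigma> i j *\<^sub>R Jmap B q (zz j) (Jmap B q (zz i) x))"
    and \<sigma>: "\<sigma> 1 2 * \<sigma> 1 3 * \<sigma> 2 3 = -1"
    using assms(3) by (elim exE conjE)
  have pair: "\<sigma> i j \<in> {-1, 1}" "\<forall>x. Jmap B q (zz i) (Jmap B q (zz j) x)
      = \<sigma> i j *\<^sub>R Jmap B q (zz j) (Jmap B q (zz i) x)"
    if "i \<in> {1,2,3}" "j \<in> {1,2,3}" for i j
    using comm that by blast+
  have "condition_C B q"
    unfolding condition_C_def
  proof (intro exI conjI)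
    show "\<forall>z\<in>{zz 1, zz 2, zz 3}. \<forall>x. Jmap B q z x = 0 \<longrightarrow> x = 0" using inj by blast
    show "{\<sigma> 1 2, \<sigma> 1 3, \<sigma> 2 3} \<subseteq> {-1, 1}"
      using pair(1)[of 1 2] pair(1)[of 1 3] pair(1)[of 2 3] by blast
  qed (rule pair \<sigma>; simp)+
  from word_functions_vanish[OF assms(1) this] obtain c where
    c: "\<And>e w. e \<in> word_functions B \<Longrightarrow> length w \<ge> c \<Longrightarrow> e w = 0"
    by blast
  have "tanaka B d = {tzero d}" if d_gt: "d > c" for d
  proof -
    \<comment> \<open>Index \<open>Suc n\<close> goes with words of length \<open>n\<close>, so
      \<open>d > c\<close> yields words of length at least \<open>c\<close>.\<close>
    obtain n where d: "d = Suc n" "n \<ge> c" using d_gt by (cases d) auto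
    have "u = tzero d" if u: "u \<in> tanaka B d" for u
      unfolding d(1)
    proof (rule eval_word_determines_tanaka[OF B(1,3)])
      show "u \<in> tanaka B (Suc n)" using u d(1) by simp
      show "eval_word B (map Inl xs) u = 0" if "length xs = n" for xs
        using c[OF eval_word_word_functions[OF B(1) u], of "map Inl xs"] that d(2) by simp
    qed
    then show ?thesis using tzero_tanaka[OF B(1)] by blast
  qed
  then have "{d. tanaka B d \<noteq> {tzero d}} \<subseteq> {..c}" by (auto simp: not_less[symmetric])
  then show ?thesis unfolding rigid_def by (rule finite_subset) simp
qed

end
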